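(* Consider the ring-road closed-loop system described in the context and suppose that $R\ge n\lambda$. Let $$E=\left\{(s,v)\in\mathbb{R}^{2n-1}: s_i\ge\lambda,\ i=2,\dots,n,\ \ \lambda+\sum_{i=2}^n s_i\le R,\ \ v_i=v^*,\ i=1,\dots,n\right\}.$$ Then there exist functions $\sigma\in KL$ and $a\in K_\infty$ such that every solution $(s(t),v(t))\in\Omega$ of the closed-loop system is defined for all $t\ge 0$ and satisfies for all $t\ge 0$ $$a\big(\mathrm{dist}((s(t),v(t)),E)\big)\le H(s(t),v(t))\le\sigma\big(H(s(0),v(0)),t\big).$$
   Context: Notation: $\mathbb{R}_+=[0,+\infty)$; $\mathrm{dist}$ is Euclidean distance to a set. Class $K$: increasing continuous $a:\mathbb{R}_+\to\mathbb{R}_+$ with $a(0)=0$; class $K_\infty$: those $a\in K$ with $\lim_{s\to+\infty}a(s)=+\infty$; class $KL$: continuous $\sigma:\mathbb{R}_+\times\mathbb{R}_+\to\mathbb{R}_+$ with $\sigma(\cdot,t)\in K$ for each $t\ge0$ and $\sigma(s,\cdot)$ non-increasing with $\lim_{t\to+\infty}\sigma(s,t)=0$ for each $s\ge 0$. Constants: integer $n\ge 2$; $R>0$; $L\in(0,n^{-1}R)$; $\lambda>L$; $v_{\max}>0$; $v^*\in(0,v_{\max})$; $\mu>0$. Functions: $V\in C^3((L,+\infty);\mathbb{R}_+)$ satisfies $\lim_{x\to L^+}V(x)=+\infty$, $V(x)=0$ for $x\ge\lambda$, and $V'(x)<0$, $V''(x)>0$ for $x\in(L,\lambda)$. $b:\mathbb{R}\to(v^*-v_{\max},v^*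 )$ is $C^2$ and increasing, with $b(0)=0$, $xb(x)>0$ for $x\ne 0$, and $b'(0)>0$. State: $s=(s_2,\dots,s_n)\in\mathbb{R}^{n-1}$, $v=(v_1,\dots,v_n)\in\mathbb{R}^n$, with conventions $s_1=s_{n+1}=R-\sum_{i=2}^n s_i$, $v_0=v_n$, $v_{n+1}=v_1$. State space (open set): $$\Omega=\Big\{(s,v)\in\mathbb{R}^{2n-1}:\ \min_{i=2,\dots,n}s_i>L,\ L+\sum_{i=2}^n s_i<R,\ \max_{i=1,\dots,n}v_i<v_{\max},\ \min_{i=1,\dots,n}v_i>0\Big\}.$$ Define, for $i=1,\dots,n$, $$f_i(s)=v^*-b\big(V'(s_{i+1})-V'(s_i)\big),$$ $$Z_i(s,v)=-v_{\max}^2\,b'\big(V'(s_{i+1})-V'(s_i)\big)\big(V''(s_{i+1})(v_i-v_{i+1})-V''(s_i)(v_{i-1}-v_i)\big),$$ and for $w,y\in(0,v_{\max})$ $$\beta(w,y)=\frac{v_{\max}^3(w+y)-2v_{\max}^2yw}{2(v_{\max}-w)^2w^2}\ (>0).$$ The ring-road closed-loop system on $\Omega$ is $$\dot{s}_i=v_{i-1}-v_i,\ i=2,\dots,n,\qquad \dot{v}_i=F_i,\ i=1,\dots,n,$$ $$F_i=\frac{1}{\beta(v_i,f_i(s))}\left(\frac{Z_i(s,v)-\mu v_{\max}^2(v_i-f_i(s))}{v_i(v_{\max}-v_i)}+V'(s_i)-V'(s_{i+1})\right).$$ The Lyapunov function $H:\Omega\to\mathbb{R}_+$ is $$H(s,v)=\frac{v_{\max}^2}{2}\sum_{i=1}^n\frac{(v_i-f_i(s))^2}{v_i(v_{\max}-v_i)}+\sum_{i=1}^nV(s_i).$$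 *)

theory Defs
  imports "HOL-Analysis.Analysis"
begin

section \<open>Comparison functions\<close>

definition class_K :: "(real \<Rightarrow> real) \<Rightarrow> bool" where
  "class_K a \<longleftrightarrow> a \<in> {0..} \<rightarrow> {0..} \<and> continuous_on {0..} a \<and> strict_mono_on {0..} a \<and> a 0 = 0"

definition class_K_inf :: "(real \<Rightarrow> real) \<Rightarrow> bool" where
  "class_K_inf a \<longleftrightarrow> class_K a \<and> filterlim a at_top at_top"

definition class_KL :: "(real \<Rightarrow> real \<Rightarrow> real) \<Rightarrow> bool" where
  "class_KL \<sigma> \<longleftrightarrow>
     continuous_on ({0..} \<times> {0..}) (\<lambda>(s, t). \<sigma> s t) \<and>
     (\<forall>t\<ge>0. class_K (\<lambda>s. \<sigma> s t)) \<and>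
     (\<forall>s\<ge>0. antimono_on {0..} (\<sigma> s) \<and> (\<sigma> s \<longlongrightarrow> 0) at_top)"

section \<open>Functions of class \<open>C\<^sup>k\<close> on an open subset of the real line\<close>

definition Ck_on :: "nat \<Rightarrow> (real \<Rightarrow> real) \<Rightarrow> real set \<Rightarrow> bool" where
  "Ck_on k f S \<longleftrightarrow>
     (\<forall>j<k. \<forall>x\<in>S. (deriv ^^ j) f field_differentiable at x) \<and>
     (\<forall>j\<le>k. continuous_on S ((deriv ^^ j) f))"

section \<open>The ring-road system\<close>

text \<open>
  There are \<open>n = CARD('n)\<close> vehicles. A state is a pair of a spacing vector in
  \<open>real^'m\<close>, where \<open>CARD('m) = n - 1\<close>, and a speed vector in \<open>real^'n\<close>; the norm
  of the product type is the Euclidean norm of \<open>\<real>\<^sup>2\<^sup>n\<^sup>-\<^sup>1\<close>.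
  The coordinates are numbered by two enumerations
  \<open>p : {2..n} \<rightarrow> 'm\<close> and \<open>q : {1..n} \<rightarrow> 'n\<close>, which are required to be bijective
  wherever the system is used.
\<close>

type_synonym ('m, 'n) state = "(real ^ 'm) \<times> (real ^ 'n)"

text \<open>\<open>spacing p R x i\<close> is \<open>s\<^sub>i\<close> for \<open>i \<in> {1..n+1}\<close>, and \<open>speed q x i\<close> is \<open>v\<^sub>i\<close>
  for \<open>i \<in> {0..n+1}\<close>, including the cyclic conventions.\<close>

definition spacing ::
  "(nat \<Rightarrow> 'm) \<Rightarrow> real \<Rightarrow> ('m::finite, 'n::finite) state \<Rightarrow> nat \<Rightarrow> real" where
  "spacing p R x i =
     (if i = 1 \<or> i = CARD('n) + 1 then R - (\<Sum>j=2..CARD('n). fst x $ p j)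
      else fst x $ p i)"

definition speed :: "(nat \<Rightarrow> 'n) \<Rightarrow> ('m::finite, 'n::finite) state \<Rightarrow> nat \<Rightarrow> real" where
  "speed q x i =
     snd x $ q (if i = 0 then CARD('n) else if i = CARD('n) + 1 then 1 else i)"

definition Omega ::
  "(nat \<Rightarrow> 'm) \<Rightarrow> (nat \<Rightarrow> 'n) \<Rightarrow> real \<Rightarrow> real \<Rightarrow> real \<Rightarrow> ('m::finite, 'n::finite) state set" where
  "Omega p q R L vmax = {x.
     (\<forall>i\<in>{2..CARD('n)}. L < spacing p R x i) \<and>
     L + (\<Sum>i=2..CARD('n). spacing p R x i) < R \<and>
     (\<forall>i\<in>{1..CARD('n)}. 0 < speed q x i \<and> speed q x i < vmax)}"

definition f_map ::
  "(nat \<Rightarrow> 'm) \<Rightarrow> real \<Rightarrow> real \<Rightarrow> (real \<Rightarrow> real) \<Rightarrow> (real \<Rightarrow> real) \<Rightarrow>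
   ('m::finite, 'n::finite) state \<Rightarrow> nat \<Rightarrow> real" where
  "f_map p R vstar V b x i =
     vstar - b (deriv V (spacing p R x (i + 1)) - deriv V (spacing p R x i))"

definition Z_map ::
  "(nat \<Rightarrow> 'm) \<Rightarrow> (nat \<Rightarrow> 'n) \<Rightarrow> real \<Rightarrow> real \<Rightarrow> (real \<Rightarrow> real) \<Rightarrow> (real \<Rightarrow> real) \<Rightarrow>
   ('m::finite, 'n::finite) state \<Rightarrow> nat \<Rightarrow> real" where
  "Z_map p q R vmax V b x i =
     - (vmax\<^sup>2) * deriv b (deriv V (spacing p R x (i + 1)) - deriv V (spacing p R x i)) *
       (deriv (deriv V) (spacing p R x (i + 1)) * (speed q x i - speed q x (i + 1)) -
        deriv (deriv V) (spacing p R x i) * (speed q x (i - 1) - speed q x i))"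

definition beta_map :: "real \<Rightarrow> real \<Rightarrow> real \<Rightarrow> real" where
  "beta_map vmax w y =
     (vmax ^ 3 * (w + y) - 2 * vmax\<^sup>2 * y * w) / (2 * (vmax - w)\<^sup>2 * w\<^sup>2)"

definition F_map ::
  "(nat \<Rightarrow> 'm) \<Rightarrow> (nat \<Rightarrow> 'n) \<Rightarrow> real \<Rightarrow> real \<Rightarrow> real \<Rightarrow> real \<Rightarrow> (real \<Rightarrow> real) \<Rightarrow> (real \<Rightarrow> real) \<Rightarrow>
   ('m::finite, 'n::finite) state \<Rightarrow> nat \<Rightarrow> real" where
  "F_map p q R vmax vstar \<mu> V b x i =
     1 / beta_map vmax (speed q x i) (f_map p R vstar V b x i) *
     ((Z_map p q R vmax V b x i - \<mu> * vmax\<^sup>2 * (speed q x i - f_map p R vstar V b x i)) /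
        (speed q x i * (vmax - speed q x i)) +
      deriv V (spacing p R x i) - deriv V (spacing p R x (i + 1)))"

definition H_map ::
  "(nat \<Rightarrow> 'm) \<Rightarrow> (nat \<Rightarrow> 'n) \<Rightarrow> real \<Rightarrow> real \<Rightarrow> real \<Rightarrow> (real \<Rightarrow> real) \<Rightarrow> (real \<Rightarrow> real) \<Rightarrow>
   ('m::finite, 'n::finite) state \<Rightarrow> real" where
  "H_map p q R vmax vstar V b x =
     vmax\<^sup>2 / 2 *
       (\<Sum>i=1..CARD('n). (speed q x i - f_map p R vstar V b x i)\<^sup>2 /
                            (speed q x i * (vmax - speed q x i))) +
     (\<Sum>i=1..CARD('n). V (spacing p R x i))"

definition E_set ::
  "(nat \<Rightarrow> 'm) \<Rightarrow> (nat \<Rightarrow> 'n) \<Rightarrow> real \<Rightarrow> real \<Rightarrow> real \<Rightarrow> ('m::finite, 'n::finite) state set" where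
  "E_set p q R lam vstar = {x.
     (\<forall>i\<in>{2..CARD('n)}. lam \<le> spacing p R x i) \<and>
     lam + (\<Sum>i=2..CARD('n). spacing p R x i) \<le> R \<and>
     (\<forall>i\<in>{1..CARD('n)}. speed q x i = vstar)}"

text \<open>A solution on \<open>[0, T)\<close>, where \<open>T\<close> may be infinite. At time \<open>0\<close> the derivative is one-sided.\<close>

definition is_solution ::
  "(nat \<Rightarrow> 'm) \<Rightarrow> (nat \<Rightarrow> 'n) \<Rightarrow> real \<Rightarrow> real \<Rightarrow> real \<Rightarrow> real \<Rightarrow> real \<Rightarrow> (real \<Rightarrow> real) \<Rightarrow> (real \<Rightarrow> real) \<Rightarrow>
   ereal \<Rightarrow> (real \<Rightarrow> ('m::finite, 'n::finite) state) \<Rightarrow> bool" where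
  "is_solution p q R L vmax vstar \<mu> V b T x \<longleftrightarrow>
     0 < T \<and>
     (\<forall>t. 0 \<le> t \<and> ereal t < T \<longrightarrow>
        x t \<in> Omega p q R L vmax \<and>
        (\<forall>i\<in>{2..CARD('n)}.
           ((\<lambda>\<tau>. spacing p R (x \<tau>) i) has_real_derivative
              speed q (x t) (i - 1) - speed q (x t) i)
             (at t within {\<tau>. 0 \<le> \<tau> \<and> ereal \<tau> < T})) \<and>
        (\<forall>i\<in>{1..CARD('n)}.
           ((\<lambda>\<tau>. speed q (x \<tau>) i) has_real_derivative
              F_map p q R vmax vstar \<mu> V b (x t) i)
             (at t within {\<tau>. 0 \<le> \<tau> \<and> ereal \<tau> < T})))"

text \<open>A solution that has no proper extension to the right as a solution in the state space.\<close>

definition is_maximal_solution ::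
  "(nat \<Rightarrow> 'm) \<Rightarrow> (nat \<Rightarrow> 'n) \<Rightarrow> real \<Rightarrow> real \<Rightarrow> real \<Rightarrow> real \<Rightarrow> real \<Rightarrow> (real \<Rightarrow> real) \<Rightarrow> (real \<Rightarrow> real) \<Rightarrow>
   ereal \<Rightarrow> (real \<Rightarrow> ('m::finite, 'n::finite) state) \<Rightarrow> bool" where
  "is_maximal_solution p q R L vmax vstar \<mu> V b T x \<longleftrightarrow>
     is_solution p q R L vmax vstar \<mu> V b T x \<and>
     \<not> (\<exists>T' y. T < T' \<and> is_solution p q R L vmax vstar \<mu> V b T' y \<and>
               (\<forall>t. 0 \<le> t \<and> ereal t < T \<longrightarrow> y t = x t))"

end

theory Submission
  imports Defs
begin

text \<open>
  The function \<open>H\<close> is a strict Lyapunov function. Its first sum was designed so that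
  \<open>\<beta>(v\<^sub>i, f\<^sub>i)\<close> is the factor multiplying the acceleration when the \<open>i\<close>-th kinetic term is differentiated;
  the feedback divides by it, the term \<open>Z\<^sub>i\<close> absorbs the drift of the target speed \<open>f\<^sub>i\<close>, and the
  potential energy exchanged between neighbours cancels around the ring. What remains is
  \<open>H' = - dissipation\<close>, where the dissipation is
  \<open>\<mu> vmax\<^sup>2 \<Sum> (v\<^sub>i - f\<^sub>i)\<^sup>2 / (v\<^sub>i (vmax - v\<^sub>i)) + \<Sum> T\<^sub>i b(T\<^sub>i)\<close> with
  \<open>T\<^sub>i = V'(s\<^sub>i\<^sub>+\<^sub>1) - V'(s\<^sub>i)\<close> (\<open>H_derivative\<close>).

  The dissipation is nonnegative, and it vanishes on the state space only on \<open>E\<close>: then all \<open>V'(s\<^sub>i)\<close> are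
  equal; the spacings add up to \<open>R \<ge> n \<lambda>\<close>, so one of them is at least \<open>\<lambda>\<close> and the common value is zero;
  hence all spacings are at least \<open>\<lambda>\<close> and all speeds equal \<open>f\<^sub>i = v\<^sup>*\<close>
  (\<open>dissipation_eq_0_imp_E\<close>). The zero set of \<open>H\<close> is \<open>E\<close> as well.

  The sublevel sets of \<open>H\<close> are compact subsets of the open state space (\<open>compact_sublevel\<close>): the barrier
  \<open>V\<close> keeps the spacings away from \<open>L\<close>, and a kinetic term blows up when a speed approaches \<open>0\<close> or
  \<open>vmax\<close>, because \<open>f\<^sub>i\<close> stays strictly between these values. As \<open>H\<close> does not increase, a solution remains in
  such a compact set. The vector field is locally Lipschitz, so a solution that stays in a compact set can be
  prolonged beyond every finite time (\<open>solution_extends_beyond_compact\<close>), and maximal solutions are global.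

  Both comparison functions come from the set of pairs of values of two functions on the state
  space. The distance \<open>\<rho>(h)\<close> of \<open>(0, h)\<close> from the set of all pairs
  \<open>(dissipation x, H x)\<close> is continuous, lies between \<open>0\<close> and \<open>h\<close>, is a lower bound of the dissipation at every
  state with \<open>H x = h\<close>, and is positive for \<open>h > 0\<close> because compactness makes the set closed. Hence
  \<open>H\<close> decays at least as fast as the solutions of \<open>y' = - \<rho>(y)\<close>, whose flow is of class \<open>KL\<close>
  (\<open>class_KL_of_decay_rate\<close>). The same idea, applied to the pairs formed by the distance to \<open>E\<close> and \<open>H\<close>,
  yields the function of class \<open>K\<^sub>\<infinity>\<close> (\<open>class_K_inf_lower_bound\<close>).
\<close>

section \<open>Comparison functions from a dissipation inequality\<close>

lemma nonincreasing_if_derivative_nonpos_within: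
  fixes f :: "real \<Rightarrow> real"
  assumes d: "\<And>t. t \<in> {a..b} \<Longrightarrow> (f has_real_derivative f' t) (at t within I)"
    and neg: "\<And>t. t \<in> {a..b} \<Longrightarrow> f' t \<le> 0"
    and I: "{a..b} \<subseteq> I" and ab: "a \<le> b"
  shows "f b \<le> f a"
proof (rule DERIV_nonpos_imp_decreasing_open[OF ab])
  have d': "(f has_real_derivative f' t) (at t within {a..b})" if "t \<in> {a..b}" for t
    using d[OF that] I by (rule DERIV_subset)
  then show "continuous_on {a..b} f"
    by (rule DERIV_continuous_on)
  show "\<exists>y. DERIV f t :> y \<and> y \<le> 0" if t: "a < t" "t < b" for t
    using d'[of t] neg[of t] t at_within_Icc_at[of a t b] by auto
qed

text \<open>
  Near a given point of the plane the second coordinate is bounded, so only the image of one compact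
  sublevel set matters there, and that image is compact.
\<close>

lemma closed_image_if_sublevels_compact:
  fixes \<phi> H :: "'a::metric_space \<Rightarrow> real"
  assumes comp: "\<And>h. compact {x \<in> X. H x \<le> h}"
    and cont: "continuous_on X \<phi>" "continuous_on X H"
  shows "closed ((\<lambda>x. (\<phi> x, H x)) ` X)"
proof -
  let ?S = "(\<lambda>x. (\<phi> x, H x)) ` X"
  have "p \<in> ?S" if p: "p \<in> closure ?S" for p
  proof -
    obtain w h where wh: "p = (w, h)"
      by fastforce
    define K where "K = {x \<in> X. H x \<le> h + 1}"
    have "continuous_on K (\<lambda>x. (\<phi> x, H x))"
      using cont by (auto intro!: continuous_on_Pair intro: continuous_on_subset simp: K_def)
    then have cl: "closed ((\<lambda>x. (\<phi> x, H x)) ` K)"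
      using comp[of "h + 1"] by (intro compact_imp_closed compact_continuous_image) (auto simp: K_def)
    have op: "open (UNIV \<times> {..<h + 1})"
      by (intro open_Times) auto
    have "p \<in> (UNIV \<times> {..<h + 1}) \<inter> closure ?S"
      using p by (auto simp: wh)
    then have "p \<in> closure ((UNIV \<times> {..<h + 1}) \<inter> ?S)"
      using open_Int_closure_subset[OF op] by blast
    also have "\<dots> \<subseteq> closure ((\<lambda>x. (\<phi> x, H x)) ` K)"
      by (intro closure_mono) (auto simp: K_def)
    also have "\<dots> = (\<lambda>x. (\<phi> x, H x)) ` K"
      using cl by simp
    finally show ?thesis
      by (auto simp: K_def)
  qed
  then have "closure ?S \<subseteq> ?S"
    by blast
  then show ?thesis
    by (simp only: closure_subset_eq)
qed

text \<open>
  The flow of the scalar equation \<open>y' = - \<rho>(y)\<close> in closed form: with an antiderivative \<open>G\<close> of \<open>1 / \<rho>\<close>, the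
  solution starting at \<open>s\<close> satisfies \<open>G(y(t)) = G(s) - t\<close>. The bound \<open>\<rho>(y) \<le> y\<close> makes \<open>G\<close> grow at
  least as fast as the logarithm, hence a bijection from the positive half-line onto the real line. Therefore the
  flow exists for all times, and it tends to zero without ever reaching it, as strict monotonicity in \<open>s\<close>
  requires. A nonnegative function \<open>\<eta>\<close> with \<open>\<eta>' \<le> - \<rho>(\<eta>)\<close> stays below the flow since
  \<open>G(\<eta>(t)) + t\<close> does not increase.
\<close>

lemma class_KL_of_decay_rate:
  fixes \<rho> :: "real \<Rightarrow> real"
  assumes cont: "continuous_on {0<..} \<rho>"
    and pos: "\<And>y. 0 < y \<Longrightarrow> 0 < \<rho> y" and le: "\<And>y. 0 < y \<Longrightarrow> \<rho> y \<le> y"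
  obtains \<sigma> where "class_KL \<sigma>"
    "\<And>\<eta> w t. \<lbrakk>\<And>t. 0 \<le> t \<Longrightarrow> 0 \<le> \<eta> t;
       \<And>t. 0 \<le> t \<Longrightarrow> (\<eta> has_real_derivative w t) (at t within {0..});
       \<And>t. 0 \<le> t \<Longrightarrow> w t \<le> 0; \<And>t. 0 \<le> t \<Longrightarrow> 0 < \<eta> t \<Longrightarrow> w t \<le> - \<rho> (\<eta> t); 0 \<le> t\<rbrakk>
     \<Longrightarrow> \<eta> t \<le> \<sigma> (\<eta> 0) t"
proof -
  have "isCont (\<lambda>y. 1 / \<rho> y) y" if "0 < y" for y
    using cont pos[of y] that
    by (intro continuous_divide continuous_const) (auto simp: continuous_on_eq_continuous_at)
  then obtain G where "\<And>y. 0 < ereal y \<Longrightarrow> (G has_vector_derivative 1 / \<rho> y) (at y)"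
    using einterval_antiderivative[of 0 \<infinity> "\<lambda>y. 1 / \<rho> y"] by (auto simp: zero_ereal_def)
  then have dG: "(G has_real_derivative 1 / \<rho> y) (at y)" if "0 < y" for y
    using that by (simp add: has_real_derivative_iff_has_vector_derivative zero_ereal_def)
  have contG: "continuous_on {0<..} G"
    using dG by (auto intro!: DERIV_continuous_on intro: DERIV_subset)
  \<comment> \<open>This is where \<open>\<rho> y \<le> y\<close> enters; it gives both limits of \<open>G\<close>.\<close>
  have G_ln: "ln z - ln y \<le> G z - G y" if "0 < y" "y \<le> z" for y z
  proof -
    have "(\<lambda>u. G u - ln u) y \<le> (\<lambda>u. G u - ln u) z"
    proof (rule DERIV_nonneg_imp_nondecreasing[OF \<open>y \<le> z\<close>])
      fix u assume u: "y \<le> u" "u \<le> z"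
      then have "0 < u"
        using that by simp
      then show "\<exists>v. ((\<lambda>u. G u - ln u) has_real_derivative v) (at u) \<and> 0 \<le> v"
        using le[of u] pos[of u]
        by (intro exI[of _ "1 / \<rho> u - 1 / u"]) (auto intro!: derivative_eq_intros dG simp: frac_le)
    qed
    then show ?thesis
      by simp
  qed
  have G_less: "G y < G z" if "0 < y" "y < z" for y z
    using G_ln[of y z] that by (smt (verit) ln_less_cancel_iff)
  have inj: "inj_on G {0<..}"
    by (rule linorder_inj_onI) (use G_less in force)+
  have surj: "\<exists>y>0. G y = u" for u
  proof (cases "G 1 \<le> u")
    case True
    define z where "z = exp (u - G 1)"
    have z: "1 \<le> z" "ln z = u - G 1"
      using True by (auto simp: z_def)
    then have "\<exists>y. 1 \<le> y \<and> y \<le> z \<and> G y = u"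
      using G_ln[of 1 z] True by (intro IVT' continuous_on_subset[OF contG]) auto
    then show ?thesis
      by (metis less_le_trans zero_less_one)
  next
    case False
    define z where "z = exp (u - G 1)"
    have z: "0 < z" "z \<le> 1" "ln z = u - G 1"
      using False by (auto simp: z_def)
    then have "\<exists>y. z \<le> y \<and> y \<le> 1 \<and> G y = u"
      using G_ln[of z 1] False by (intro IVT' continuous_on_subset[OF contG]) auto
    then show ?thesis
      using z by (metis less_le_trans)
  qed
  then have im: "G ` {0<..} = UNIV"
    by (metis UNIV_eq_I greaterThan_iff imageI)
  \<comment> \<open>The inverse of a strictly increasing bijection onto the real line is continuous because it is monotone with open range.\<close>
  define J where "J = the_inv_into {0<..} G"
  have GJ: "G (J u) = u" and Jpos: "0 < J u" for u
    using f_the_inv_into_f[OF inj, of u] the_inv_into_into[OF inj, of u "{0<..}"] im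
    by (auto simp: J_def)
  have JG: "J (G y) = y" if "0 < y" for y
    using that by (simp add: J_def the_inv_into_f_f[OF inj])
  have J_less: "J u < J v" if "u < v" for u v
    using that G_less[of "J v" "J u"] GJ Jpos by (metis linorder_cases less_asym)
  then have J_le: "J u \<le> J v" if "u \<le> v" for u v
    using that by (metis le_less)
  have "J ` UNIV = {0<..}"
    using Jpos JG by (auto simp: image_iff) metis
  then have contJ: "continuous_on UNIV J"
    by (intro continuous_onI_mono) (auto intro: J_le)
  define \<sigma> where "\<sigma> = (\<lambda>s t. if s \<le> 0 then 0 else J (G s - t))"
  have \<sigma>_nonneg: "0 \<le> \<sigma> s t" for s t
    using Jpos[of "G s - t"] by (simp add: \<sigma>_def)
  have \<sigma>_le: "\<sigma> s t \<le> s" if "0 \<le> s" "0 \<le> t" for s t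
    using J_le[of "G s - t" "G s"] JG[of s] that by (auto simp: \<sigma>_def)
  have cont\<sigma>: "continuous_on ({0..} \<times> {0..}) (\<lambda>(s, t). \<sigma> s t)"
    unfolding continuous_on_eq_continuous_within
  proof
    fix p :: "real \<times> real" assume "p \<in> {0..} \<times> {0..}"
    then obtain s t where p: "p = (s, t)" "0 \<le> s" "0 \<le> t"
      by auto
    show "continuous (at p within {0..} \<times> {0..}) (\<lambda>(s, t). \<sigma> s t)"
    proof (cases "s = 0")
      case False
      have op: "open ({0<..} \<times> (UNIV :: real set) :: (real \<times> real) set)"
        by (intro open_Times) auto
      have "continuous_on ({0<..} \<times> (UNIV :: real set)) (\<lambda>p. J (G (fst p) - snd p))"
        by (rule continuous_on_compose2[OF contJ])
          (auto intro!: continuous_intros continuous_on_compose2[OF contG])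
      then have "continuous_on ({0<..} \<times> (UNIV :: real set)) (\<lambda>(s, t). \<sigma> s t)"
        by (rule continuous_on_eq) (auto simp: \<sigma>_def)
      then have "isCont (\<lambda>(s, t). \<sigma> s t) p"
        using op p False by (simp add: continuous_on_eq_continuous_at)
      then show ?thesis
        by (rule continuous_at_imp_continuous_at_within)
    next
      case True
      have "((\<lambda>(s, t). \<sigma> s t) \<longlongrightarrow> 0) (at p within {0..} \<times> {0..})"
      proof (rule tendsto_sandwich[where f = "\<lambda>_. 0" and h = fst])
        show "(fst \<longlongrightarrow> 0) (at p within {0..} \<times> {0..})"
          using p True by (auto intro!: tendsto_eq_intros)
        show "eventually (\<lambda>p. (\<lambda>(s, t). \<sigma> s t) p \<le> fst p) (at p within {0..} \<times> {0..})"
          by (auto simp: eventually_at_filter \<sigma>_le intro!: always_eventually)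
      qed (auto simp: \<sigma>_nonneg intro!: always_eventually)
      then show ?thesis
        using p True by (simp add: continuous_within \<sigma>_def)
    qed
  qed
  have "class_K (\<lambda>s. \<sigma> s t)" if t: "0 \<le> t" for t
    unfolding class_K_def
  proof (intro conjI)
    have "continuous_on {0..} (\<lambda>s. case (s, t) of (s, t) \<Rightarrow> \<sigma> s t)"
      by (rule continuous_on_compose2[OF cont\<sigma>]) (use t in \<open>auto intro!: continuous_intros\<close>)
    then show "continuous_on {0..} (\<lambda>s. \<sigma> s t)"
      by simp
    show "strict_mono_on {0..} (\<lambda>s. \<sigma> s t)"
      by (rule strict_mono_onI) (auto simp: \<sigma>_def Jpos intro!: J_less G_less)
    show "\<sigma> 0 t = 0"
      by (simp add: \<sigma>_def)
  qed (auto simp: \<sigma>_nonneg)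
  moreover have "antimono_on {0..} (\<sigma> s)" for s
  proof (rule monotone_onI)
    fix t u :: real assume "t \<le> u"
    then show "\<sigma> s u \<le> \<sigma> s t"
      using J_le[of "G s - u" "G s - t"] by (simp add: \<sigma>_def)
  qed
  moreover have "(\<sigma> s \<longlongrightarrow> 0) at_top" for s
  proof (rule order_tendstoI)
    show "eventually (\<lambda>t. \<sigma> s t < e) at_top" if "0 < e" for e
      using eventually_gt_at_top[of "G s - G e"]
    proof eventually_elim
      case (elim t)
      then show ?case
        using J_less[of "G s - t" "G e"] JG[OF \<open>0 < e\<close>] \<open>0 < e\<close> by (auto simp: \<sigma>_def)
    qed
    show "eventually (\<lambda>t. e < \<sigma> s t) at_top" if "e < 0" for e
      using \<sigma>_nonneg[of s] that by (auto intro!: always_eventually intro: less_le_trans)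
  qed
  ultimately have "class_KL \<sigma>"
    using cont\<sigma> by (auto simp: class_KL_def)
  moreover have "\<eta> t \<le> \<sigma> (\<eta> 0) t"
    if nonneg: "\<And>t. 0 \<le> t \<Longrightarrow> 0 \<le> \<eta> t"
      and d: "\<And>t. 0 \<le> t \<Longrightarrow> (\<eta> has_real_derivative w t) (at t within {0..})"
      and w: "\<And>t. 0 \<le> t \<Longrightarrow> w t \<le> 0" "\<And>t. 0 \<le> t \<Longrightarrow> 0 < \<eta> t \<Longrightarrow> w t \<le> - \<rho> (\<eta> t)"
      and t: "0 \<le> t" for \<eta> w t
  proof (cases "\<eta> t = 0")
    case True
    then show ?thesis
      using \<sigma>_nonneg by simp
  next
    case False
    have pos\<eta>: "0 < \<eta> r" if r: "r \<in> {0..t}" for r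
    proof -
      have "\<eta> t \<le> \<eta> r"
        by (rule nonincreasing_if_derivative_nonpos_within[of r t _ w "{0..}"]) (use r d w in auto)
      then show ?thesis
        using False nonneg[OF t] by linarith
    qed
    have "(\<lambda>r. G (\<eta> r) + r) t \<le> (\<lambda>r. G (\<eta> r) + r) 0"
    proof (rule nonincreasing_if_derivative_nonpos_within[of 0 t])
      fix r assume r: "r \<in> {0..t}"
      show "((\<lambda>r. G (\<eta> r) + r) has_real_derivative 1 / \<rho> (\<eta> r) * w r + 1) (at r within {0..})"
        by (rule DERIV_add[OF DERIV_chain2[OF dG[OF pos\<eta>[OF r]] d] DERIV_ident]) (use r in auto)
      show "1 / \<rho> (\<eta> r) * w r + 1 \<le> 0"
        using w(2)[of r] pos\<eta>[OF r] pos[of "\<eta> r"] r by (auto simp: field_simps)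
    qed (use t in auto)
    then have "J (G (\<eta> t)) \<le> J (G (\<eta> 0) - t)"
      by (intro J_le) simp
    then show ?thesis
      using pos\<eta>[of t] pos\<eta>[of 0] t by (simp add: JG \<sigma>_def)
  qed
  ultimately show thesis
    using that by blast
qed

text \<open>
  Reduction of a Lyapunov inequality on a state space \<open>X\<close> to a scalar decay rate: \<open>\<rho>(h)\<close> is the distance of
  \<open>(0, h)\<close> from the set of pairs \<open>(W x, H x)\<close>. Using a distance makes the rate continuous without further
  construction; an infimum of \<open>W\<close> over the level sets of \<open>H\<close> need not be.
\<close>

lemma class_KL_of_dissipation:
  fixes W H :: "'a::metric_space \<Rightarrow> real"
  assumes comp: "\<And>h. compact {x \<in> X. H x \<le> h}"
    and cont: "continuous_on X W" "continuous_on X H"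
    and nonneg: "\<And>x. x \<in> X \<Longrightarrow> 0 \<le> W x" "\<And>x. x \<in> X \<Longrightarrow> 0 \<le> H x"
    and W0: "\<And>x. x \<in> X \<Longrightarrow> W x = 0 \<Longrightarrow> H x = 0"
    and e: "e \<in> X" "W e = 0"
  obtains \<sigma> where "class_KL \<sigma>"
    "\<And>x t. \<lbrakk>\<And>t. 0 \<le> t \<Longrightarrow> x t \<in> X;
       \<And>t. 0 \<le> t \<Longrightarrow> ((\<lambda>t. H (x t)) has_real_derivative - W (x t)) (at t within {0..}); 0 \<le> t\<rbrakk>
     \<Longrightarrow> H (x t) \<le> \<sigma> (H (x 0)) t"
proof -
  define S where "S = (\<lambda>x. (W x, H x)) ` X"
  have S: "closed S"
    unfolding S_def by (rule closed_image_if_sublevels_compact[OF comp cont])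
  have zero: "(0, 0) \<in> S"
    using e W0[OF e] by (force simp: S_def)
  define \<rho> where "\<rho> = (\<lambda>h. infdist (0, h) S)"
  have \<rho>_cont: "continuous_on {0<..} \<rho>"
    unfolding \<rho>_def by (intro continuous_intros)
  have \<rho>_pos: "0 < \<rho> h" if "0 < h" for h
  proof -
    have "(0, h) \<notin> S"
      using W0 that by (auto simp: S_def)
    then show ?thesis
      unfolding \<rho>_def using zero by (intro infdist_pos_not_in_closed S) auto
  qed
  have \<rho>_le: "\<rho> h \<le> h" if "0 < h" for h
    unfolding \<rho>_def using infdist_le[OF zero, of "(0, h)"] that by (simp add: dist_Pair_Pair)
  have W_ge: "\<rho> (H x) \<le> W x" if "x \<in> X" for x
    unfolding \<rho>_def using infdist_le[of "(W x, H x)" S "(0, H x)"] nonneg(1)[OF that] that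
    by (auto simp: S_def dist_Pair_Pair)
  show thesis
  proof (rule class_KL_of_decay_rate[OF \<rho>_cont \<rho>_pos \<rho>_le])
    fix \<sigma>
    assume KL: "class_KL \<sigma>"
      and \<sigma>: "\<And>\<eta> w t. \<lbrakk>\<And>t. 0 \<le> t \<Longrightarrow> 0 \<le> \<eta> t;
       \<And>t. 0 \<le> t \<Longrightarrow> (\<eta> has_real_derivative w t) (at t within {0..});
       \<And>t. 0 \<le> t \<Longrightarrow> w t \<le> 0; \<And>t. 0 \<le> t \<Longrightarrow> 0 < \<eta> t \<Longrightarrow> w t \<le> - \<rho> (\<eta> t); 0 \<le> t\<rbrakk>
     \<Longrightarrow> \<eta> t \<le> \<sigma> (\<eta> 0) t"
    show thesis
    proof (rule that[OF KL])
      fix x :: "real \<Rightarrow> 'a" and t :: real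
      assume x: "\<And>t. 0 \<le> t \<Longrightarrow> x t \<in> X"
        "\<And>t. 0 \<le> t \<Longrightarrow> ((\<lambda>t. H (x t)) has_real_derivative - W (x t)) (at t within {0..})" and t: "0 \<le> t"
      show "H (x t) \<le> \<sigma> (H (x 0)) t"
        by (rule \<sigma>[of "\<lambda>t. H (x t)" "\<lambda>t. - W (x t)"]) (use x t nonneg W_ge in auto)
    qed
  qed auto
qed

text \<open>
  The set \<open>S\<close> below is the set of pairs \<open>(D x, H x)\<close>, closed downwards in the first coordinate. The distance
  of \<open>(d, 0)\<close> from it is again continuous and at most \<open>H x\<close> at \<open>d = D x\<close>; the downward closure makes it
  monotone in \<open>d\<close>, and it is unbounded because \<open>D\<close> is bounded. The factor \<open>d / (1 + d)\<close> turns
  monotonicity into strict monotonicity.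
\<close>

lemma class_K_inf_lower_bound:
  fixes D H :: "'a \<Rightarrow> real"
  assumes D: "\<And>x. x \<in> X \<Longrightarrow> 0 \<le> D x" "\<And>x. x \<in> X \<Longrightarrow> D x \<le> M"
    and H: "\<And>x. x \<in> X \<Longrightarrow> 0 \<le> H x"
    and e: "e \<in> X" "H e = 0"
    and away: "\<And>d. 0 < d \<Longrightarrow> \<exists>m>0. \<forall>x\<in>X. d \<le> D x \<longrightarrow> m \<le> H x"
  obtains a where "class_K_inf a" "\<And>x. x \<in> X \<Longrightarrow> a (D x) \<le> H x"
proof -
  define S where "S = {q. \<exists>x\<in>X. fst q \<le> D x \<and> snd q = H x}"
  have zero: "(0, 0) \<in> S"
    unfolding S_def using e D(1)[OF e(1)] by (intro CollectI bexI[of _ e]) simp_all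
  have inf: "c \<le> infdist p S" if "\<And>q. q \<in> S \<Longrightarrow> c \<le> dist p q" for c and p :: "real \<times> real"
    using that zero by (subst infdist_notempty) (auto intro!: cINF_greatest)
  define \<alpha> where "\<alpha> = (\<lambda>d. infdist (d, 0) S)"
  have nonneg: "0 \<le> \<alpha> d" for d
    by (simp add: \<alpha>_def infdist_nonneg)
  have mono: "\<alpha> c \<le> \<alpha> d" if "c \<le> d" for c d
    unfolding \<alpha>_def
  proof (rule inf)
    fix q assume "q \<in> S"
    then obtain r x where q: "q = (r, H x)" "x \<in> X" "r \<le> D x"
      by (cases q) (auto simp: S_def)
    then have "(r - (d - c), H x) \<in> S"
      using that by (auto simp: S_def intro!: bexI[of _ x])
    then have "infdist (c, 0) S \<le> dist (c, 0) (r - (d - c), H x)"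
      by (rule infdist_le)
    also have "\<dots> = dist (d, 0) q"
      by (simp add: q dist_Pair_Pair dist_real_def algebra_simps)
    finally show "infdist (c, 0) S \<le> dist (d, 0) q" .
  qed
  have pos: "0 < \<alpha> d" if d: "0 < d" for d
  proof -
    obtain m where m: "m > 0" "\<And>x. x \<in> X \<Longrightarrow> d / 2 \<le> D x \<Longrightarrow> m \<le> H x"
      using away[of "d / 2"] d by auto
    \<comment> \<open>A pair is far from \<open>(d, 0)\<close> horizontally if its first coordinate is at most \<open>d / 2\<close>, and vertically otherwise.\<close>
    have "min m (d / 2) \<le> \<alpha> d"
      unfolding \<alpha>_def
    proof (rule inf)
      fix q assume "q \<in> S"
      then obtain r x where q: "q = (r, H x)" "x \<in> X" "r \<le> D x"
        by (cases q) (auto simp: S_def)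
      have "\<bar>d - r\<bar> \<le> dist (d, 0) q" "\<bar>H x\<bar> \<le> dist (d, 0) q"
        using dist_fst_le[of "(d, 0)" q] dist_snd_le[of "(d, 0)" q] by (auto simp: q dist_real_def)
      then show "min m (d / 2) \<le> dist (d, 0) q"
        using m(2)[of x] q d by (cases "r \<le> d / 2") auto
    qed
    then show ?thesis
      using m(1) d by linarith
  qed
  have lin: "d - M \<le> \<alpha> d" for d
    unfolding \<alpha>_def
  proof (rule inf)
    fix q assume "q \<in> S"
    then obtain r x where q: "q = (r, H x)" "x \<in> X" "r \<le> D x"
      by (cases q) (auto simp: S_def)
    then show "d - M \<le> dist (d, 0) q"
      using dist_fst_le[of "(d, 0)" q] D(2)[of x] by (auto simp: dist_real_def)
  qed
  define a where "a = (\<lambda>d. \<alpha> d * (d / (1 + d)))"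
  have "class_K a"
    unfolding class_K_def
  proof (intro conjI)
    show "continuous_on {0..} a"
      unfolding a_def \<alpha>_def by (intro continuous_intros) auto
    show "strict_mono_on {0..} a"
    proof (rule strict_mono_onI)
      fix c d :: real assume cd: "c \<in> {0..}" "c < d"
      have "\<alpha> c * (c / (1 + c)) \<le> \<alpha> d * (c / (1 + c))"
        using cd by (intro mult_right_mono mono) auto
      also have "\<dots> < \<alpha> d * (d / (1 + d))"
        using cd by (intro mult_strict_left_mono pos) (auto simp: field_simps)
      finally show "a c < a d"
        by (simp add: a_def)
    qed
  qed (auto simp: a_def nonneg)
  moreover have "filterlim a at_top at_top"
  proof (rule filterlim_at_top_mono)
    \<comment> \<open>The factor \<open>d / (1 + d)\<close> is at least \<open>1 / 2\<close> from \<open>d = 1\<close> on.\<close>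
    show "filterlim (\<lambda>d. 1 / 2 * (d - M)) at_top at_top"
      unfolding filterlim_at_top
    proof
      fix Z
      show "eventually (\<lambda>d. Z \<le> 1 / 2 * (d - M)) at_top"
        using eventually_ge_at_top[of "2 * Z + M"] by eventually_elim simp
    qed
    show "eventually (\<lambda>d. 1 / 2 * (d - M) \<le> a d) at_top"
      using eventually_ge_at_top[of 1]
    proof eventually_elim
      case (elim d)
      have "1 / 2 * (d - M) \<le> 1 / 2 * \<alpha> d"
        using lin[of d] by simp
      also have "\<dots> \<le> d / (1 + d) * \<alpha> d"
        using elim by (intro mult_right_mono nonneg) (auto simp: field_simps)
      finally show ?case
        by (simp add: a_def mult.commute)
    qed
  qed
  moreover have "a (D x) \<le> H x" if x: "x \<in> X" for x
  proof -
    have "a (D x) \<le> \<alpha> (D x) * 1"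
      unfolding a_def using D(1)[OF x] nonneg by (intro mult_left_mono) auto
    also have "\<dots> \<le> H x"
      using infdist_le[of "(D x, H x)" S "(D x, 0)"] H[OF x] x
      by (auto simp: S_def \<alpha>_def dist_Pair_Pair)
    finally show ?thesis .
  qed
  ultimately show thesis
    using that by (auto simp: class_K_inf_def)
qed

section \<open>Local Lipschitz continuity\<close>

text \<open>
  Lipschitz continuity on some neighbourhood of a point: the local form needed for Picard iteration that is
  stable under arithmetic and composition.
\<close>

definition lipschitz_near :: "('a::metric_space \<Rightarrow> 'b::metric_space) \<Rightarrow> 'a \<Rightarrow> bool" where
  "lipschitz_near f x \<longleftrightarrow> (\<exists>C U. open U \<and> x \<in> U \<and> C-lipschitz_on U f)"

lemma lipschitz_nearI:
  "open U \<Longrightarrow> x \<in> U \<Longrightarrow> C-lipschitz_on U f \<Longrightarrow> lipschitz_near f x"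
  by (auto simp: lipschitz_near_def)

lemma lipschitz_nearE:
  assumes "lipschitz_near f x"
  obtains C U where "open U" "x \<in> U" "C-lipschitz_on U f"
  using assms by (auto simp: lipschitz_near_def)

lemma lipschitz_near_continuous:
  assumes "lipschitz_near f x"
  shows "isCont f x"
proof -
  obtain C U where U: "open U" "x \<in> U" "C-lipschitz_on U f"
    using assms by (rule lipschitz_nearE)
  then show ?thesis
    by (metis at_within_open lipschitz_on_continuous_within)
qed

lemma lipschitz_near_const: "lipschitz_near (\<lambda>x. c) x"
  by (rule lipschitz_nearI[of UNIV _ 0]) (auto intro: lipschitz_on_constant)

lemma lipschitz_near_bounded_linear:
  assumes "bounded_linear f"
  shows "lipschitz_near f x"
proof -
  obtain B where "B-lipschitz_on UNIV f"
    using bounded_linear.lipschitz_boundE[OF assms] by blast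
  then show ?thesis
    by (intro lipschitz_nearI[of UNIV]) auto
qed

lemma lipschitz_near_add:
  fixes f g :: "'a::metric_space \<Rightarrow> 'b::real_normed_vector"
  assumes "lipschitz_near f x" "lipschitz_near g x"
  shows "lipschitz_near (\<lambda>x. f x + g x) x"
proof -
  obtain C U D T where "open U" "x \<in> U" "C-lipschitz_on U f" "open T" "x \<in> T" "D-lipschitz_on T g"
    using assms by (auto elim!: lipschitz_nearE)
  then show ?thesis
    by (intro lipschitz_nearI[of "U \<inter> T" _ "C + D"] lipschitz_on_add)
      (auto intro: lipschitz_on_subset)
qed

lemma lipschitz_near_compose:
  assumes f: "lipschitz_near f x" and g: "lipschitz_near g (f x)"
  shows "lipschitz_near (\<lambda>x. g (f x)) x"
proof -
  obtain C U D T where U: "open U" "x \<in> U" "C-lipschitz_on U f"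
    and T: "open T" "f x \<in> T" "D-lipschitz_on T g"
    using assms by (auto elim!: lipschitz_nearE)
  define W where "W = U \<inter> f -` T"
  have W: "open W"
    unfolding W_def
    by (rule continuous_open_preimage[OF lipschitz_on_continuous_on[OF U(3)] U(1) T(1)])
  have "(D * C)-lipschitz_on W (\<lambda>x. g (f x))"
    by (rule lipschitz_on_compose2[of C W f D g])
      (use U T in \<open>auto simp: W_def intro: lipschitz_on_subset\<close>)
  then show ?thesis
    by (rule lipschitz_nearI[OF W, rotated]) (use U T in \<open>auto simp: W_def\<close>)
qed

lemma lipschitz_near_C1:
  fixes g :: "real \<Rightarrow> real"
  assumes S: "open S" "y \<in> S"
    and d: "\<And>u. u \<in> S \<Longrightarrow> (g has_real_derivative g' u) (at u)"
    and c: "continuous_on S g'"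
  shows "lipschitz_near g y"
proof -
  obtain e where e: "e > 0" "cball y e \<subseteq> S"
    using S open_contains_cball by blast
  have "compact (g' ` cball y e)"
    by (intro compact_continuous_image continuous_on_subset[OF c] e compact_cball)
  then obtain B where B: "B > 0" "\<And>u. u \<in> cball y e \<Longrightarrow> \<bar>g' u\<bar> \<le> B"
    using compact_imp_bounded bounded_pos by (metis image_eqI real_norm_def)
  have "B-lipschitz_on (cball y e) g"
  proof (rule bounded_derivative_imp_lipschitz)
    show "(g has_derivative (\<lambda>h. h * g' u)) (at u within cball y e)" if "u \<in> cball y e" for u
    proof -
      have "u \<in> S"
        using that e by auto
      then show ?thesis
        using d[of u]
        by (auto simp: has_field_derivative_def mult_commute_abs intro: has_derivative_at_withinI)
    qed
    show "onorm (\<lambda>h. h * g' u) \<le> B" if "u \<in> cball y e" for u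
      using B(2)[OF that] B(1) by (intro onorm_bound) (auto simp: abs_mult mult.commute[of B] intro: mult_left_mono)
  qed (use B in auto)
  then show ?thesis
    by (intro lipschitz_nearI[of "ball y e" _ B]) (use e in \<open>auto intro: lipschitz_on_subset\<close>)
qed

lemma lipschitz_near_cmult:
  fixes f :: "'a::metric_space \<Rightarrow> real"
  assumes "lipschitz_near f x"
  shows "lipschitz_near (\<lambda>x. c * f x) x"
  by (rule lipschitz_near_compose[OF assms])
    (rule lipschitz_near_bounded_linear[OF bounded_linear_mult_right])

lemma lipschitz_near_diff:
  fixes f g :: "'a::metric_space \<Rightarrow> real"
  assumes "lipschitz_near f x" "lipschitz_near g x"
  shows "lipschitz_near (\<lambda>x. f x - g x) x"
  using lipschitz_near_add[OF assms(1) lipschitz_near_cmult[OF assms(2), of "-1"]] by simp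

lemma lipschitz_near_power:
  fixes f :: "'a::metric_space \<Rightarrow> real"
  assumes "lipschitz_near f x"
  shows "lipschitz_near (\<lambda>x. f x ^ k) x"
  by (rule lipschitz_near_compose[OF assms], rule lipschitz_near_C1[of UNIV])
    (auto intro!: derivative_eq_intros continuous_intros)

text \<open>
  By polarization, products reduce to sums and squares.
\<close>

lemma lipschitz_near_mult:
  fixes f g :: "'a::metric_space \<Rightarrow> real"
  assumes "lipschitz_near f x" "lipschitz_near g x"
  shows "lipschitz_near (\<lambda>x. f x * g x) x"
proof -
  have "f x * g x = 1/4 * ((f x + g x)\<^sup>2 - (f x - g x)\<^sup>2)" for x
    by (simp add: power2_eq_square algebra_simps)
  then show ?thesis
    using assms
    by (simp only:) (intro lipschitz_near_cmult lipschitz_near_diff lipschitz_near_power lipschitz_near_add)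
qed

lemma lipschitz_near_divide:
  fixes f g :: "'a::metric_space \<Rightarrow> real"
  assumes "lipschitz_near f x" "lipschitz_near g x" "g x \<noteq> 0"
  shows "lipschitz_near (\<lambda>x. f x / g x) x"
proof -
  have "lipschitz_near inverse (g x)"
    by (rule lipschitz_near_C1[of "- {0}" _ _ "\<lambda>u. - (inverse u * inverse u)"])
      (use assms(3) in \<open>auto intro!: derivative_eq_intros continuous_intros simp: power2_eq_square\<close>)
  then show ?thesis
    unfolding divide_inverse
    by (rule lipschitz_near_mult[OF assms(1) lipschitz_near_compose[OF assms(2)]])
qed

lemma lipschitz_near_sum:
  fixes f :: "'i \<Rightarrow> 'a::metric_space \<Rightarrow> 'b::real_normed_vector"
  assumes "\<And>i. i \<in> I \<Longrightarrow> lipschitz_near (f i) x"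
  shows "lipschitz_near (\<lambda>x. \<Sum>i\<in>I. f i x) x"
  using assms
  by (induction I rule: infinite_finite_induct)
    (auto intro: lipschitz_near_const lipschitz_near_add)

lemma lipschitz_near_euclidean:
  fixes f :: "'a::metric_space \<Rightarrow> 'b::euclidean_space"
  assumes "\<And>e. e \<in> Basis \<Longrightarrow> lipschitz_near (\<lambda>x. f x \<bullet> e) x"
  shows "lipschitz_near f x"
proof -
  have "lipschitz_near (\<lambda>x. \<Sum>e\<in>Basis. (f x \<bullet> e) *\<^sub>R e) x"
    by (intro lipschitz_near_sum lipschitz_near_compose[OF assms] lipschitz_near_bounded_linear
        bounded_linear_scaleR_left)
  then show ?thesis
    by (simp add: euclidean_representation)
qed

section \<open>Existence and continuation of solutions of differential equations\<close>

text \<open>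
  If a continuous function has the derivative \<open>g\<close> outside a finite set and \<open>g\<close> is continuous everywhere, then
  the function is the integral of \<open>g\<close>, so the exceptional points are differentiability points too. This
  is what allows two solutions to be joined.
\<close>

lemma has_vector_derivative_across_exceptions:
  fixes y g :: "real \<Rightarrow> 'a::euclidean_space"
  assumes y: "continuous_on {a..b} y" and g: "continuous_on {a..b} g" and "finite S"
    and d: "\<And>t. t \<in> {a<..<b} - S \<Longrightarrow> (y has_vector_derivative g t) (at t)"
    and t: "t \<in> {a..b}"
  shows "(y has_vector_derivative g t) (at t within {a..b})"
proof -
  have *: "y u = y a + integral {a..u} g" if u: "u \<in> {a..b}" for u
  proof -
    have "(g has_integral (y u - y a)) {a..u}"
      using u \<open>finite S\<close> d
      by (intro fundamental_theorem_of_calculus_interior_strong[of S])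
        (auto intro: continuous_on_subset[OF y])
    then show ?thesis by (simp add: integral_unique)
  qed
  have "((\<lambda>u. y a + integral {a..u} g) has_vector_derivative g t) (at t within {a..b})"
    using integral_has_vector_derivative[OF g t]
    by (auto intro!: derivative_eq_intros)
  then show ?thesis
    by (rule has_vector_derivative_transform[OF t, rotated]) (rule *)
qed

text \<open>
  Picard iteration for a globally Lipschitz field on an interval so short that the integral operator is a
  contraction in the supremum norm. The operator acts on bounded continuous functions on the whole line by
  freezing the time at the ends of the interval.
\<close>

lemma picard_global:
  fixes G :: "'a::euclidean_space \<Rightarrow> 'a"
  assumes G: "C-lipschitz_on UNIV G" and h: "0 \<le> h" "C * h < 1"
  obtains z where "z 0 = x0" "continuous_on {0..h} z"
    "\<And>t. t \<in> {0..h} \<Longrightarrow> (z has_vector_derivative G (z t)) (at t within {0..h})"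
proof -
  have C: "0 \<le> C"
    using G by (rule lipschitz_on_nonneg)
  have Gu: "continuous_on T (\<lambda>s. G (apply_bcontfun u s))" for T and u :: "real \<Rightarrow>\<^sub>C 'a"
    by (rule continuous_on_compose2[OF lipschitz_on_continuous_on[OF G]]) auto
  have int: "(\<lambda>s. G (apply_bcontfun u s)) integrable_on {a..b}" for a b and u :: "real \<Rightarrow>\<^sub>C 'a"
    by (intro integrable_continuous_real Gu)
  have "\<exists>w :: real \<Rightarrow>\<^sub>C 'a. \<forall>t. w t = x0 + integral {0..clamp 0 h t} (\<lambda>s. G (u s))"
    for u :: "real \<Rightarrow>\<^sub>C 'a"
  proof -
    have "continuous_on (cbox 0 h) (\<lambda>t. x0 + integral {0..t} (\<lambda>s. G (u s)))"
      using int by (auto intro!: continuous_intros indefinite_integral_continuous_1)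
    then show ?thesis
      by (rule continuous_on_cbox_bcontfunE) blast
  qed
  then obtain \<Phi> :: "(real \<Rightarrow>\<^sub>C 'a) \<Rightarrow> (real \<Rightarrow>\<^sub>C 'a)"
    where \<Phi>: "\<And>u t. \<Phi> u t = x0 + integral {0..clamp 0 h t} (\<lambda>s. G (u s))"
    by metis
  have "dist (\<Phi> u) (\<Phi> w) \<le> (C * h) * dist u w" for u w
  proof (rule dist_bound)
    fix t
    define c where "c = clamp 0 h t"
    have c: "0 \<le> c" "c \<le> h"
      using clamp_in_interval[of 0 h t] h by (auto simp: c_def)
    have "dist (\<Phi> u t) (\<Phi> w t) = norm (integral {0..c} (\<lambda>s. G (u s) - G (w s)))"
      by (simp add: \<Phi> c_def dist_norm integral_diff int)
    also have "\<dots> \<le> (C * dist u w) * (c - 0)"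
    proof (rule integral_bound)
      show "continuous_on {0..c} (\<lambda>s. G (u s) - G (w s))"
        by (intro continuous_on_diff Gu)
      fix s
      have "norm (G (u s) - G (w s)) \<le> C * dist (u s) (w s)"
        using lipschitz_onD[OF G, of "u s" "w s"] by (simp add: dist_norm)
      also have "\<dots> \<le> C * dist u w"
        by (intro mult_left_mono dist_bounded C)
      finally show "norm (G (u s) - G (w s)) \<le> C * dist u w" .
    qed (use c in auto)
    also have "\<dots> \<le> (C * dist u w) * h"
      using c C by (intro mult_left_mono) auto
    finally show "dist (\<Phi> u t) (\<Phi> w t) \<le> (C * h) * dist u w"
      by (simp add: mult_ac)
  qed
  then obtain u where u: "\<Phi> u = u"
    using banach_fix_type[of "C * h" \<Phi>] C h by auto
  have ut: "u t = x0 + integral {0..t} (\<lambda>s. G (u s))" if "t \<in> {0..h}" for t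
    using \<Phi>[of u t] that by (simp add: u)
  show thesis
  proof (rule that[of "apply_bcontfun u"])
    show "u 0 = x0"
      using ut[of 0] h by simp
    show "(u has_vector_derivative G (u t)) (at t within {0..h})" if t: "t \<in> {0..h}" for t
    proof (rule has_vector_derivative_transform[OF t ut])
      show "((\<lambda>t. x0 + integral {0..t} (\<lambda>s. G (u s))) has_vector_derivative G (u t)) (at t within {0..h})"
        using integral_has_vector_derivative[OF Gu t, of u]
        by (auto intro!: derivative_eq_intros)
    qed
  qed auto
qed

text \<open>
  Composing the field with the projection onto a closed ball makes it globally Lipschitz without changing it on
  the ball; the resulting solution remains in the ball for a short time, where it solves the original equation.
\<close>

lemma picard_local:
  fixes F :: "'a::euclidean_space \<Rightarrow> 'a"
  assumes F: "lipschitz_near F x0" and \<Omega>: "open \<Omega>" "x0 \<in> \<Omega>"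
  obtains h z where "0 < h" "z 0 = x0" "continuous_on {0..h} z"
    "\<And>t. t \<in> {0..h} \<Longrightarrow> z t \<in> \<Omega>"
    "\<And>t. t \<in> {0..h} \<Longrightarrow> (z has_vector_derivative F (z t)) (at t within {0..h})"
proof -
  obtain C U where U: "open U" "x0 \<in> U" "C-lipschitz_on U F"
    using F by (rule lipschitz_nearE)
  then have "open (U \<inter> \<Omega>)" "x0 \<in> U \<inter> \<Omega>"
    using \<Omega> by auto
  then obtain r where r: "0 < r" "cball x0 r \<subseteq> U \<inter> \<Omega>"
    using open_contains_cball by blast
  define B where "B = cball x0 r"
  have B: "convex B" "closed B" "B \<noteq> {}" "B \<subseteq> U" "B \<subseteq> \<Omega>"
    using r by (auto simp: B_def)
  define G where "G = (\<lambda>x. F (closest_point B x))"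
  have C: "0 \<le> C"
    using U(3) by (rule lipschitz_on_nonneg)
  have G: "C-lipschitz_on UNIV G"
  proof (rule lipschitz_onI[OF _ C])
    fix x y
    have "dist (G x) (G y) \<le> C * dist (closest_point B x) (closest_point B y)"
      unfolding G_def using closest_point_in_set[OF B(2,3)] B(4)
      by (intro lipschitz_onD[OF U(3)]) auto
    also have "\<dots> \<le> C * dist x y"
      by (intro mult_left_mono closest_point_lipschitz B C)
    finally show "dist (G x) (G y) \<le> C * dist x y" .
  qed
  \<comment> \<open>Adding \<open>1\<close> to the Lipschitz constant avoids a division by zero.\<close>
  define k where "k = 1 / (2 * (C + 1))"
  have k: "0 < k" "C * k < 1"
    using C by (auto simp: k_def divide_simps)
  obtain z where z: "z 0 = x0" "continuous_on {0..k} z"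
    and dz: "\<And>t. t \<in> {0..k} \<Longrightarrow> (z has_vector_derivative G (z t)) (at t within {0..k})"
    using picard_global[OF G, of k] k by (metis less_imp_le)
  obtain d where d: "d > 0" "\<And>t. t \<in> {0..k} \<Longrightarrow> dist t 0 < d \<Longrightarrow> dist (z t) (z 0) < r"
    using z(2) r(1) k(1) unfolding continuous_on_iff by (metis atLeastAtMost_iff less_imp_le order_refl)
  define h where "h = min k (d / 2)"
  have h: "0 < h" "h \<le> k" "h < d"
    using d(1) k(1) by (auto simp: h_def)
  have zB: "z t \<in> B" if "t \<in> {0..h}" for t
    using d(2)[of t] that h z(1) by (auto simp: B_def dist_commute)
  show thesis
  proof (rule that[of h z])
    show "continuous_on {0..h} z"
      using z(2) h by (auto intro: continuous_on_subset)
    fix t assume t: "t \<in> {0..h}"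
    show "z t \<in> \<Omega>"
      using zB[OF t] B by auto
    have "(z has_vector_derivative G (z t)) (at t within {0..h})"
      using dz[of t] t h by (auto intro: has_vector_derivative_within_subset)
    then show "(z has_vector_derivative F (z t)) (at t within {0..h})"
      using zB[OF t] by (simp add: G_def closest_point_self)
  qed (use h z in auto)
qed

text \<open>
  On a compact set the field is bounded, so the solution is Lipschitz in time and has a limit at the end of its
  interval of existence. This limit is again in the compact set, and a local solution starting there continues the
  given one.
\<close>

lemma solution_extends_beyond_compact:
  fixes F :: "'a::euclidean_space \<Rightarrow> 'a"
  assumes \<Omega>: "open \<Omega>" and F: "\<And>x. x \<in> \<Omega> \<Longrightarrow> lipschitz_near F x"
    and K: "compact K" "K \<subseteq> \<Omega>" and T: "0 < T"
    and xK: "\<And>t. t \<in> {0..<T} \<Longrightarrow> x t \<in> K"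
    and dx: "\<And>t. t \<in> {0..<T} \<Longrightarrow> (x has_vector_derivative F (x t)) (at t within {0..<T})"
  obtains T' y where "T < T'" "\<And>t. t \<in> {0..<T} \<Longrightarrow> y t = x t"
    "\<And>t. t \<in> {0..<T'} \<Longrightarrow> y t \<in> \<Omega>"
    "\<And>t. t \<in> {0..<T'} \<Longrightarrow> (y has_vector_derivative F (y t)) (at t within {0..<T'})"
proof -
  have contF: "continuous_on \<Omega> F"
    using F lipschitz_near_continuous by (blast intro: continuous_at_imp_continuous_on)
  have "bounded (F ` K)"
    by (intro compact_imp_bounded compact_continuous_image continuous_on_subset[OF contF] K)
  then obtain B where B: "B > 0" "\<And>u. u \<in> K \<Longrightarrow> norm (F u) \<le> B"
    by (auto simp: bounded_pos)
  have "B-lipschitz_on {0..<T} x"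
  proof (rule bounded_derivative_imp_lipschitz)
    show "(x has_derivative (\<lambda>h. h *\<^sub>R F (x t))) (at t within {0..<T})" if "t \<in> {0..<T}" for t
      using dx[OF that] by (simp add: has_vector_derivative_def)
    show "onorm (\<lambda>h. h *\<^sub>R F (x t)) \<le> B" if "t \<in> {0..<T}" for t
      using B(2)[OF xK[OF that]] B(1)
      by (intro onorm_bound) (auto simp: mult.commute[of B] intro: mult_left_mono)
  qed (use B in auto)
  then obtain x' where x': "B-lipschitz_on (closure {0..<T}) x'" "\<And>t. t \<in> {0..<T} \<Longrightarrow> x' t = x t"
    using lipschitz_extend_closure[of B "{0..<T}" x] by blast
  have cl: "closure {0..<T} = {0..T}"
    using T by simp
  have cx': "continuous_on {0..T} x'"
    using x'(1) lipschitz_on_continuous_on by (simp add: cl)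
  have "x' ` closure {0..<T} \<subseteq> K"
    using xK x'(2) K(1) cx'
    by (intro image_closure_subset) (auto simp: cl compact_imp_closed)
  then have x'K: "x' t \<in> K" if "t \<in> {0..T}" for t
    using that cl by auto
  then have xT: "x' T \<in> \<Omega>"
    using K T by auto
  obtain h z where h: "0 < h" and z: "z 0 = x' T" "continuous_on {0..h} z"
    and z\<Omega>: "\<And>t. t \<in> {0..h} \<Longrightarrow> z t \<in> \<Omega>"
    and dz: "\<And>t. t \<in> {0..h} \<Longrightarrow> (z has_vector_derivative F (z t)) (at t within {0..h})"
    using picard_local[OF F[OF xT] \<Omega> xT] by metis
  define y where "y = (\<lambda>t. if t \<le> T then x' t else z (t - T))"
  have y\<Omega>: "y t \<in> \<Omega>" if "t \<in> {0..T + h}" for t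
    using that x'K[of t] K z\<Omega>[of "t - T"] by (auto simp: y_def)
  have un: "{0..T + h} = {0..T} \<union> {T..T + h}"
    using T h by auto
  have cy: "continuous_on {0..T + h} y"
    unfolding y_def un
  proof (rule continuous_on_If)
    show "continuous_on {T..T + h} (\<lambda>t. z (t - T))"
      by (rule continuous_on_compose2[OF z(2)]) (auto intro!: continuous_intros)
  qed (use T h z cx' in auto)
  have cFy: "continuous_on {0..T + h} (\<lambda>t. F (y t))"
    by (rule continuous_on_compose2[OF contF cy]) (use y\<Omega> in auto)
  have dy: "(y has_vector_derivative F (y t)) (at t)" if t: "t \<in> {0<..<T + h} - {T}" for t
  proof (cases "t < T")
    case True
    have "(x has_vector_derivative F (x t)) (at t within {0<..<T})"
      using dx[of t] t True by (auto intro: has_vector_derivative_within_subset)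
    moreover have "at t within {0<..<T} = at t"
      using t True by (intro at_within_open) auto
    ultimately have "(x has_vector_derivative F (x t)) (at t)"
      by simp
    then have "(y has_vector_derivative F (x t)) (at t)"
      by (rule has_vector_derivative_transform_within_open[of _ _ _ "{0<..<T}"])
        (use t True x'(2) in \<open>auto simp: y_def\<close>)
    then show ?thesis
      using t True x'(2) by (simp add: y_def)
  next
    case False
    then have tT: "T < t" "t < T + h"
      using t by auto
    have "(z has_vector_derivative F (z (t - T))) (at (t - T) within {0<..<h})"
      using dz[of "t - T"] tT by (auto intro: has_vector_derivative_within_subset)
    moreover have "at (t - T) within {0<..<h} = at (t - T)"
      using tT by (intro at_within_open) auto
    ultimately have "(z has_vector_derivative F (z (t - T))) (at (t - T))"
      by simp
    then have "((\<lambda>u. z (u - T)) has_vector_derivative F (z (t - T))) (at t)"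
      using vector_diff_chain_at[of "\<lambda>u. u - T" 1 t z "F (z (t - T))"]
      by (auto simp: o_def has_vector_derivative_diff_const intro!: derivative_eq_intros)
    then have "(y has_vector_derivative F (z (t - T))) (at t)"
      by (rule has_vector_derivative_transform_within_open[of _ _ _ "{T<..}"])
        (use tT in \<open>auto simp: y_def\<close>)
    then show ?thesis
      using tT by (simp add: y_def)
  qed
  show thesis
  proof (rule that[of "T + h" y])
    show "y t = x t" if "t \<in> {0..<T}" for t
      using that x'(2) by (auto simp: y_def)
    show "(y has_vector_derivative F (y t)) (at t within {0..<T + h})" if "t \<in> {0..<T + h}" for t
      using has_vector_derivative_across_exceptions[OF cy cFy, of "{T}" t] dy that
      by (auto intro: has_vector_derivative_within_subset)
    show "T < T + h"
      using h by simp
    show "y t \<in> \<Omega>" if "t \<in> {0..<T + h}" for t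
      using that by (intro y\<Omega>) auto
  qed
qed

section \<open>The kinetic term and sums around a ring\<close>

lemma has_vector_derivative_vec:
  fixes f :: "real \<Rightarrow> real ^ 'n"
  assumes "\<And>j. ((\<lambda>t. f t $ j) has_vector_derivative f' $ j) (at t within S)"
  shows "(f has_vector_derivative f') (at t within S)"
  unfolding has_vector_derivative_def
  by (subst has_derivative_componentwise_within)
    (use assms in \<open>auto simp: Basis_vec_def inner_axis has_vector_derivative_def\<close>)

lemma sum_cyclic_shift:
  fixes g :: "nat \<Rightarrow> 'a::comm_monoid_add"
  assumes "g (n + 1) = g 1"
  shows "(\<Sum>i=1..n. g (i + 1)) = (\<Sum>i=1..n. g i)"
proof (cases n)
  case (Suc k)
  have "(\<Sum>i=1..n. g (i + 1)) = (\<Sum>i=2..n+1. g i)"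
    by (rule sum.reindex_bij_witness[of _ "\<lambda>i. i - 1" "\<lambda>i. i + 1"]) auto
  also have "\<dots> = (\<Sum>i=2..n. g i) + g 1"
    using Suc assms by simp
  also have "\<dots> = (\<Sum>i=1..n. g i)"
    using Suc sum.atLeast_Suc_atMost[of 1 n g] by (simp add: numeral_2_eq_2 add.commute)
  finally show ?thesis .
qed simp

lemma beta_map_pos:
  assumes "0 < w" "w < vmax" "0 < y" "y < vmax"
  shows "0 < beta_map vmax w y"
proof -
  have "vmax ^ 3 * (w + y) - 2 * vmax\<^sup>2 * y * w = vmax\<^sup>2 * (w * (vmax - y) + y * (vmax - w))"
    by (simp add: power2_eq_square power3_eq_cube algebra_simps)
  also have "\<dots> > 0"
    using assms by (intro mult_pos_pos add_pos_pos) auto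
  finally show ?thesis
    using assms by (simp add: beta_map_def)
qed

text \<open>
  The weight \<open>beta_map\<close> is exactly the partial derivative of the kinetic term with respect to the speed,
  divided by the speed error.
\<close>

lemma kinetic_term_derivative:
  fixes v f :: "real \<Rightarrow> real"
  assumes v: "(v has_real_derivative v') (at t within I)"
    and f: "(f has_real_derivative f') (at t within I)"
    and range: "0 < v t" "v t < vmax"
  shows "((\<lambda>t. vmax\<^sup>2 / 2 * ((v t - f t)\<^sup>2 / (v t * (vmax - v t)))) has_real_derivative
      (v t - f t) * (beta_map vmax (v t) (f t) * v' - vmax\<^sup>2 * f' / (v t * (vmax - v t))))
    (at t within I)"
proof -
  have nz: "v t \<noteq> 0" "vmax - v t \<noteq> 0"
    using range by auto
  have num: "((\<lambda>t. (v t - f t)\<^sup>2) has_real_derivative 2 * (v t - f t) * (v' - f')) (at t within I)"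
    by (auto intro!: derivative_eq_intros v f)
  have den: "((\<lambda>t. v t * (vmax - v t)) has_real_derivative v' * (vmax - v t) - v t * v') (at t within I)"
    by (auto intro!: derivative_eq_intros v simp: algebra_simps)
  have "((\<lambda>t. vmax\<^sup>2 / 2 * ((v t - f t)\<^sup>2 / (v t * (vmax - v t)))) has_real_derivative
      vmax\<^sup>2 / 2 * ((2 * (v t - f t) * (v' - f') * (v t * (vmax - v t))
        - (v t - f t)\<^sup>2 * (v' * (vmax - v t) - v t * v')) / (v t * (vmax - v t) * (v t * (vmax - v t)))))
    (at t within I)"
    using nz by (intro DERIV_cmult DERIV_divide[OF num den]) simp
  also have "vmax\<^sup>2 / 2 * ((2 * (v t - f t) * (v' - f') * (v t * (vmax - v t))
        - (v t - f t)\<^sup>2 * (v' * (vmax - v t) - v t * v')) / (v t * (vmax - v t) * (v t * (vmax - v t)))) =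
      (v t - f t) * (beta_map vmax (v t) (f t) * v' - vmax\<^sup>2 * f' / (v t * (vmax - v t)))"
    using nz unfolding beta_map_def
    by (simp add: divide_simps) (simp add: power2_eq_square power3_eq_cube algebra_simps)
  finally show ?thesis .
qed

lemma sum_differences:
  fixes a :: "nat \<Rightarrow> real"
  assumes "1 \<le> m"
  shows "(\<Sum>i=2..m. a (i - 1) - a i) = a 1 - a m"
  using assms by (induction m rule: nat_induct_at_least) simp_all

section \<open>The ring road\<close>

text \<open>
  The assumption \<open>R_ge\<close> leaves enough room for all vehicles to be out of interaction. Without it the
  average spacing would be less than \<open>lam\<close>, and \<open>E\<close> would be empty.
\<close>

locale ring_road =
  fixes p :: "nat \<Rightarrow> 'm::finite" and q :: "nat \<Rightarrow> 'n::finite"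
    and R L lam vmax vstar \<mu> :: real
    and V b :: "real \<Rightarrow> real"
  assumes n_ge_2: "2 \<le> CARD('n)"
    and p_bij: "bij_betw p {2..CARD('n)} UNIV"
    and q_bij: "bij_betw q {1..CARD('n)} UNIV"
    and L_pos: "0 < L"
    and L_less_lam: "L < lam"
    and vstar_bounds: "0 < vstar" "vstar < vmax"
    and \<mu>_pos: "0 < \<mu>"
    and V_C3: "Ck_on 3 V {L<..}"
    and V_nonneg: "L < x \<Longrightarrow> 0 \<le> V x"
    and V_barrier: "filterlim V at_top (at_right L)"
    and V_zero: "lam \<le> x \<Longrightarrow> V x = 0"
    and V_decreasing: "L < x \<Longrightarrow> x < lam \<Longrightarrow> deriv V x < 0"
    and b_range: "range b \<subseteq> {vstar - vmax<..<vstar}"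
    and b_C2: "Ck_on 2 b UNIV"
    and b_0: "b 0 = 0"
    and b_sign: "x \<noteq> 0 \<Longrightarrow> 0 < x * b x"
    and R_ge: "real CARD('n) * lam \<le> R"
begin

abbreviation s :: "('m, 'n) state \<Rightarrow> nat \<Rightarrow> real" where "s \<equiv> spacing p R"
abbreviation v :: "('m, 'n) state \<Rightarrow> nat \<Rightarrow> real" where "v \<equiv> speed q"
abbreviation \<Omega> :: "('m, 'n) state set" where "\<Omega> \<equiv> Omega p q R L vmax"
abbreviation f :: "('m, 'n) state \<Rightarrow> nat \<Rightarrow> real" where "f \<equiv> f_map p R vstar V b"
abbreviation Z :: "('m, 'n) state \<Rightarrow> nat \<Rightarrow> real" where "Z \<equiv> Z_map p q R vmax V b"
abbreviation F :: "('m, 'n) state \<Rightarrow> nat \<Rightarrow> real" where "F \<equiv> F_map p q R vmax vstar \<mu> V b"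
abbreviation H :: "('m, 'n) state \<Rightarrow> real" where "H \<equiv> H_map p q R vmax vstar V b"
abbreviation E :: "('m, 'n) state set" where "E \<equiv> E_set p q R lam vstar"

text \<open>
  The argument of \<open>b\<close> in the target speed: the imbalance of the repulsive forces on a vehicle.
\<close>

definition tension :: "('m, 'n) state \<Rightarrow> nat \<Rightarrow> real" where
  "tension x i = deriv V (s x (i + 1)) - deriv V (s x i)"

definition dissipation :: "('m, 'n) state \<Rightarrow> real" where
  "dissipation x =
     \<mu> * vmax\<^sup>2 * (\<Sum>i=1..CARD('n). (v x i - f x i)\<^sup>2 / (v x i * (vmax - v x i))) +
     (\<Sum>i=1..CARD('n). tension x i * b (tension x i))"

lemma f_eq: "f x i = vstar - b (tension x i)"
  by (simp add: f_map_def tension_def)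

section \<open>Cyclic coordinates\<close>

lemma spacing_Suc_n: "s x (CARD('n) + 1) = s x 1"
  by (simp add: spacing_def)

lemma spacing_1: "s x 1 = R - (\<Sum>i=2..CARD('n). s x i)"
proof -
  have "(\<Sum>i=2..CARD('n). s x i) = (\<Sum>i=2..CARD('n). fst x $ p i)"
    by (rule sum.cong) (auto simp: spacing_def)
  then show ?thesis
    by (simp add: spacing_def)
qed

lemma speed_0: "v x 0 = v x CARD('n)" and speed_Suc_n: "v x (CARD('n) + 1) = v x 1"
  using n_ge_2 by (auto simp: speed_def)

lemma sum_from_1: "(\<Sum>i=1..CARD('n). g i) = g 1 + (\<Sum>i=2..CARD('n). g i)" for g :: "nat \<Rightarrow> real"
  using sum.atLeast_Suc_atMost[of 1 "CARD('n)" g] n_ge_2 by (simp add: numeral_2_eq_2)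

lemma sum_spacing: "(\<Sum>i=1..CARD('n). s x i) = R"
  using spacing_1[of x] by (simp only: sum_from_1)

lemma indices_1_n: "{1..CARD('n)} = insert 1 {2..CARD('n)}"
  using n_ge_2 by auto

lemma Omega_iff: "x \<in> \<Omega> \<longleftrightarrow> (\<forall>i\<in>{1..CARD('n)}. L < s x i \<and> 0 < v x i \<and> v x i < vmax)"
proof -
  have "L + (\<Sum>i=2..CARD('n). s x i) < R \<longleftrightarrow> L < s x 1"
    using spacing_1[of x] by auto
  then show ?thesis
    unfolding Omega_def mem_Collect_eq indices_1_n by auto
qed

lemma E_iff: "x \<in> E \<longleftrightarrow> (\<forall>i\<in>{1..CARD('n)}. lam \<le> s x i \<and> v x i = vstar)"
proof -
  have "lam + (\<Sum>i=2..CARD('n). s x i) \<le> R \<longleftrightarrow> lam \<le> s x 1"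
    using spacing_1[of x] by auto
  then show ?thesis
    unfolding E_set_def mem_Collect_eq indices_1_n by auto
qed

text \<open>
  The spacing with index \<open>n + 1\<close> is the first one again.
\<close>

lemma spacing_gt:
  assumes "\<And>i. i \<in> {1..CARD('n)} \<Longrightarrow> c < s x i" "i \<in> {1..CARD('n)+1}"
  shows "c < s x i"
proof (cases "i = CARD('n) + 1")
  case True
  then show ?thesis
    using assms(1)[of 1] n_ge_2 by (simp only: spacing_Suc_n) simp
next
  case False
  then show ?thesis
    using assms(2) by (intro assms(1)) auto
qed

lemma Omega_spacing: "x \<in> \<Omega> \<Longrightarrow> i \<in> {1..CARD('n)+1} \<Longrightarrow> L < s x i"
  by (rule spacing_gt) (auto simp: Omega_iff)

lemma Omega_speed: "x \<in> \<Omega> \<Longrightarrow> i \<in> {1..CARD('n)} \<Longrightarrow> 0 < v x i \<and> v x i < vmax"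
  by (auto simp: Omega_iff)

lemma bounded_linear_speed: "bounded_linear (\<lambda>x. v x i)"
  unfolding speed_def
  by (rule bounded_linear_compose[OF bounded_linear_vec_nth bounded_linear_snd])

lemma lipschitz_near_speed: "lipschitz_near (\<lambda>x. v x i) x"
  by (rule lipschitz_near_bounded_linear[OF bounded_linear_speed])

lemma lipschitz_near_spacing: "lipschitz_near (\<lambda>x. s x i) x"
proof -
  have *: "lipschitz_near (\<lambda>x :: ('m, 'n) state. fst x $ j) x" for j
    by (rule lipschitz_near_bounded_linear[OF
          bounded_linear_compose[OF bounded_linear_vec_nth bounded_linear_fst]])
  show ?thesis
    unfolding spacing_def
    by (cases "i = 1 \<or> i = CARD('n) + 1")
      (simp_all add: * lipschitz_near_diff lipschitz_near_const lipschitz_near_sum)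
qed

lemmas isCont_speed = lipschitz_near_speed[THEN lipschitz_near_continuous]
lemmas isCont_spacing = lipschitz_near_spacing[THEN lipschitz_near_continuous]

lemma state_with_coordinates:
  "\<exists>x :: ('m, 'n) state. (\<forall>i\<in>{2..CARD('n)}. s x i = a i) \<and> (\<forall>i\<in>{1..CARD('n)}. v x i = c i)"
proof (intro exI conjI ballI)
  let ?x = "(\<chi> j. a (inv_into {2..CARD('n)} p j), \<chi> j. c (inv_into {1..CARD('n)} q j)) :: ('m, 'n) state"
  show "s ?x i = a i" if "i \<in> {2..CARD('n)}" for i
    using that bij_betw_inv_into_left[OF p_bij that] by (simp add: spacing_def)
  show "v ?x i = c i" if "i \<in> {1..CARD('n)}" for i
    using that bij_betw_inv_into_left[OF q_bij that] by (simp add: speed_def)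
qed

section \<open>The potential and the coupling function\<close>

lemma V_deriv:
  assumes "L < x"
  shows "(V has_real_derivative deriv V x) (at x)"
    and "(deriv V has_real_derivative deriv (deriv V) x) (at x)"
    and "(deriv (deriv V) has_real_derivative deriv (deriv (deriv V)) x) (at x)"
proof -
  have "(deriv ^^ j) V field_differentiable at x" if "j < 3" for j
    using V_C3 assms that by (auto simp: Ck_on_def)
  from this[of 0] this[of 1] this[of 2]
  show "(V has_real_derivative deriv V x) (at x)"
    "(deriv V has_real_derivative deriv (deriv V) x) (at x)"
    "(deriv (deriv V) has_real_derivative deriv (deriv (deriv V)) x) (at x)"
    by (auto simp: DERIV_deriv_iff_field_differentiable numeral_2_eq_2)
qed

lemma V_deriv_cont:
  "continuous_on {L<..} (deriv V)" "continuous_on {L<..} (deriv (deriv V))"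
  "continuous_on {L<..} (deriv (deriv (deriv V)))"
proof -
  have "continuous_on {L<..} ((deriv ^^ j) V)" if "j \<le> 3" for j
    using V_C3 that by (auto simp: Ck_on_def)
  from this[of 1] this[of 2] this[of 3]
  show "continuous_on {L<..} (deriv V)" "continuous_on {L<..} (deriv (deriv V))"
    "continuous_on {L<..} (deriv (deriv (deriv V)))"
    by (auto simp: numeral_2_eq_2 numeral_3_eq_3)
qed

lemma b_deriv:
  "(b has_real_derivative deriv b x) (at x)"
  "(deriv b has_real_derivative deriv (deriv b) x) (at x)"
proof -
  have "(deriv ^^ j) b field_differentiable at x" if "j < 2" for j
    using b_C2 that by (auto simp: Ck_on_def)
  from this[of 0] this[of 1]
  show "(b has_real_derivative deriv b x) (at x)"
    "(deriv b has_real_derivative deriv (deriv b) x) (at x)"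
    by (auto simp: DERIV_deriv_iff_field_differentiable)
qed

lemma b_deriv_cont: "continuous_on UNIV (deriv b)" "continuous_on UNIV (deriv (deriv b))"
proof -
  have "continuous_on UNIV ((deriv ^^ j) b)" if "j \<le> 2" for j
    using b_C2 that by (auto simp: Ck_on_def)
  from this[of 1] this[of 2]
  show "continuous_on UNIV (deriv b)" "continuous_on UNIV (deriv (deriv b))"
    by (auto simp: numeral_2_eq_2)
qed

lemma f_bounds: "0 < f x i \<and> f x i < vmax"
  using subsetD[OF b_range rangeI, of "tension x i"] by (auto simp: f_eq)

lemma b_nonneg: "0 \<le> x * b x"
  using b_sign[of x] by (cases "x = 0") auto

text \<open>
  A zero of the nonnegative function \<open>V\<close> is a minimum. In particular the derivative vanishes at the
  interaction distance itself.
\<close>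

lemma V_deriv_zero_if_V_zero:
  assumes "L < x" "V x = 0"
  shows "deriv V x = 0"
proof (rule DERIV_local_min[OF V_deriv(1)[OF assms(1)]])
  show "\<forall>y. \<bar>x - y\<bar> < x - L \<longrightarrow> V x \<le> V y"
    using assms V_nonneg by (auto simp: abs_if split: if_splits)
qed (use assms in auto)

lemma V_deriv_eq_0_iff: "L < x \<Longrightarrow> deriv V x = 0 \<longleftrightarrow> lam \<le> x"
  using V_deriv_zero_if_V_zero[of x] V_zero[of x] V_decreasing[of x] L_less_lam by force

lemma V_eq_0_iff: "L < x \<Longrightarrow> V x = 0 \<longleftrightarrow> lam \<le> x"
  using V_deriv_zero_if_V_zero[of x] V_zero[of x] V_deriv_eq_0_iff[of x] by blast

section \<open>Zeros of the Lyapunov function and of its dissipation\<close>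

lemma kinetic_nonneg:
  assumes "x \<in> \<Omega>" "i \<in> {1..CARD('n)}"
  shows "0 \<le> (v x i - f x i)\<^sup>2 / (v x i * (vmax - v x i))"
  using Omega_speed[OF assms] by simp

lemma kinetic_eq_0_iff:
  assumes "x \<in> \<Omega>" "i \<in> {1..CARD('n)}"
  shows "(v x i - f x i)\<^sup>2 / (v x i * (vmax - v x i)) = 0 \<longleftrightarrow> v x i = f x i"
  using Omega_speed[OF assms] by simp

lemma V_spacing_nonneg:
  assumes "x \<in> \<Omega>" "i \<in> {1..CARD('n)}"
  shows "0 \<le> V (s x i)"
  using Omega_spacing[OF assms(1), of i] assms(2) by (auto intro: V_nonneg)

lemma vmax_pos: "0 < vmax"
  using vstar_bounds by simp

lemma H_nonneg: "x \<in> \<Omega> \<Longrightarrow> 0 \<le> H x"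
  unfolding H_map_def
  by (intro add_nonneg_nonneg mult_nonneg_nonneg sum_nonneg kinetic_nonneg V_spacing_nonneg) auto

lemma dissipation_nonneg: "x \<in> \<Omega> \<Longrightarrow> 0 \<le> dissipation x"
  unfolding dissipation_def using \<mu>_pos
  by (intro add_nonneg_nonneg mult_nonneg_nonneg sum_nonneg kinetic_nonneg b_nonneg) auto

lemma E_subset_Omega: "E \<subseteq> \<Omega>"
  using L_less_lam vstar_bounds by (force simp: E_iff Omega_iff)

lemma E_tension:
  assumes "x \<in> E" "i \<in> {1..CARD('n)}"
  shows "tension x i = 0"
proof -
  have "deriv V (s x j) = 0" if "j \<in> {1..CARD('n)+1}" for j
  proof -
    have "lam \<le> s x j"
      using assms(1) that spacing_Suc_n[of x] n_ge_2 by (cases "j = CARD('n) + 1") (auto simp: E_iff)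
    then show ?thesis
      using V_deriv_eq_0_iff[of "s x j"] L_less_lam by auto
  qed
  from this[of i] this[of "i + 1"] show ?thesis
    using assms(2) by (simp add: tension_def)
qed

lemma on_E:
  assumes "x \<in> E"
  shows "H x = 0" "dissipation x = 0"
proof -
  have "v x i = f x i" if "i \<in> {1..CARD('n)}" for i
    using assms that E_tension[OF assms that] by (auto simp: E_iff f_eq b_0)
  moreover have "V (s x i) = 0" if "i \<in> {1..CARD('n)}" for i
    using assms that by (auto simp: E_iff V_zero)
  ultimately show "H x = 0" "dissipation x = 0"
    using E_tension[OF assms] by (auto simp: H_map_def dissipation_def b_0)
qed

text \<open>
  Without interaction the tensions vanish, so the target speeds equal \<open>vstar\<close>.
\<close>

lemma in_E_if:
  assumes x: "x \<in> \<Omega>" and s: "\<And>i. i \<in> {1..CARD('n)} \<Longrightarrow> lam \<le> s x i"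
    and v: "\<And>i. i \<in> {1..CARD('n)} \<Longrightarrow> v x i = f x i"
  shows "x \<in> E"
proof -
  have "deriv V (s x i) = 0" if "i \<in> {1..CARD('n)}" for i
    using s[OF that] Omega_spacing[OF x, of i] that by (auto simp: V_deriv_eq_0_iff)
  then have "tension x i = 0" if "i \<in> {1..CARD('n)}" for i
    using that n_ge_2 spacing_Suc_n[of x] by (cases "i = CARD('n)") (auto simp: tension_def)
  then show ?thesis
    using s v by (auto simp: E_iff f_eq b_0)
qed

lemma H_eq_0_imp_E:
  assumes x: "x \<in> \<Omega>" and H: "H x = 0"
  shows "x \<in> E"
proof -
  let ?k = "\<Sum>i=1..CARD('n). (v x i - f x i)\<^sup>2 / (v x i * (vmax - v x i))"
  have "0 \<le> ?k" "0 \<le> (\<Sum>i=1..CARD('n). V (s x i))"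
    by (intro sum_nonneg kinetic_nonneg V_spacing_nonneg x; assumption)+
  then have k0: "?k = 0" and V0: "(\<Sum>i=1..CARD('n). V (s x i)) = 0"
    using H vmax_pos by (auto simp: H_map_def add_nonneg_eq_0_iff)
  have *: "v x i = f x i" if "i \<in> {1..CARD('n)}" for i
    unfolding kinetic_eq_0_iff[OF x that, symmetric]
    by (rule sum_nonneg_0[OF finite_atLeastAtMost _ k0 that]) (rule kinetic_nonneg[OF x])
  have **: "V (s x i) = 0" if "i \<in> {1..CARD('n)}" for i
    by (rule sum_nonneg_0[OF finite_atLeastAtMost _ V0 that]) (rule V_spacing_nonneg[OF x])
  show ?thesis
  proof (rule in_E_if[OF x])
    fix i assume i: "i \<in> {1..CARD('n)}"
    show "lam \<le> s x i"
      using **[OF i] Omega_spacing[OF x, of i] i by (auto simp: V_eq_0_iff)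
    show "v x i = f x i"
      by (rule *[OF i])
  qed
qed

text \<open>
  Vanishing tensions make \<open>deriv V\<close> constant around the ring. Since the spacings add up to at least
  \<open>n\<close> times the interaction distance, one of them is out of interaction, which makes the constant zero.
\<close>

lemma dissipation_eq_0_imp_E:
  assumes x: "x \<in> \<Omega>" and W: "dissipation x = 0"
  shows "x \<in> E"
proof -
  let ?k = "\<Sum>i=1..CARD('n). (v x i - f x i)\<^sup>2 / (v x i * (vmax - v x i))"
  have "0 \<le> ?k" "0 \<le> (\<Sum>i=1..CARD('n). tension x i * b (tension x i))"
    by (intro sum_nonneg kinetic_nonneg b_nonneg x; assumption)+
  then have k0: "?k = 0" and t0: "(\<Sum>i=1..CARD('n). tension x i * b (tension x i)) = 0"
    using W vmax_pos \<mu>_pos by (auto simp: dissipation_def add_nonneg_eq_0_iff)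
  have v: "v x i = f x i" if "i \<in> {1..CARD('n)}" for i
    unfolding kinetic_eq_0_iff[OF x that, symmetric]
    by (rule sum_nonneg_0[OF finite_atLeastAtMost _ k0 that]) (rule kinetic_nonneg[OF x])
  have tension: "tension x i = 0" if "i \<in> {1..CARD('n)}" for i
  proof -
    have "tension x i * b (tension x i) = 0"
      by (rule sum_nonneg_0[OF finite_atLeastAtMost _ t0 that]) (rule b_nonneg)
    then show ?thesis
      using b_sign[of "tension x i"] by fastforce
  qed
  have const: "deriv V (s x i) = deriv V (s x 1)" if "i \<in> {1..CARD('n)}" for i
    using that
  proof (induction i)
    case (Suc i)
    then show ?case
      using tension[of i] by (cases "i = 0") (auto simp: tension_def)
  qed simp
  have "\<exists>i\<in>{1..CARD('n)}. lam \<le> s x i"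
  proof (rule ccontr)
    assume "\<not> ?thesis"
    then have "(\<Sum>i=1..CARD('n). s x i) < (\<Sum>i=1..CARD('n). lam)"
      using n_ge_2 by (intro sum_strict_mono) (auto simp: not_le)
    then show False
      using sum_spacing[of x] R_ge by simp
  qed
  then obtain k where k: "k \<in> {1..CARD('n)}" "lam \<le> s x k"
    by blast
  then have "deriv V (s x k) = 0"
    using Omega_spacing[OF x, of k] by (auto simp: V_deriv_eq_0_iff)
  then have "deriv V (s x i) = 0" if "i \<in> {1..CARD('n)}" for i
    using const[OF that] const[OF k(1)] by simp
  then show ?thesis
    using v Omega_spacing[OF x] by (intro in_E_if[OF x]) (auto simp: V_deriv_eq_0_iff)
qed

text \<open>
  Equally spaced vehicles driving at speed \<open>vstar\<close>.
\<close>

lemma E_nonempty: "E \<noteq> {}"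
proof -
  obtain x :: "('m, 'n) state" where x: "\<And>i. i \<in> {2..CARD('n)} \<Longrightarrow> s x i = R / CARD('n)"
    "\<And>i. i \<in> {1..CARD('n)} \<Longrightarrow> v x i = vstar"
    using state_with_coordinates[of "\<lambda>_. R / CARD('n)" "\<lambda>_. vstar"] by blast
  have "s x 1 = R - (\<Sum>i=2..CARD('n). R / CARD('n))"
    unfolding spacing_1 using x by simp
  also have "\<dots> = R / CARD('n)"
    using n_ge_2 by (simp add: of_nat_diff field_simps)
  finally have "s x i = R / CARD('n)" if "i \<in> {1..CARD('n)}" for i
    using x that by (cases "i = 1") auto
  moreover have "lam \<le> R / CARD('n)"
    using R_ge n_ge_2 by (simp add: field_simps)
  ultimately have "x \<in> E"
    using x by (simp add: E_iff)
  then show ?thesis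
    by blast
qed

section \<open>Compact sublevel sets\<close>

lemma isCont_deriv_V_spacing:
  assumes "L < s x i"
  shows "isCont (\<lambda>x. deriv V (s x i)) x"
  by (rule isCont_o2[OF isCont_spacing DERIV_isCont[OF V_deriv(2)[OF assms]]])

lemma isCont_V_spacing:
  assumes "L < s x i"
  shows "isCont (\<lambda>x. V (s x i)) x"
  by (rule isCont_o2[OF isCont_spacing DERIV_isCont[OF V_deriv(1)[OF assms]]])

lemma isCont_tension:
  assumes "L < s x i" "L < s x (i + 1)"
  shows "isCont (\<lambda>x. tension x i) x"
  unfolding tension_def by (intro continuous_intros isCont_deriv_V_spacing assms)

lemma isCont_b_compose: "isCont g x \<Longrightarrow> isCont (\<lambda>x. b (g x)) x"
  by (rule isCont_o2[OF _ DERIV_isCont[OF b_deriv(1)]])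

lemma isCont_f:
  assumes "L < s x i" "L < s x (i + 1)"
  shows "isCont (\<lambda>x. f x i) x"
  unfolding f_eq
  by (intro continuous_intros isCont_b_compose isCont_tension assms)

lemma isCont_kinetic:
  assumes x: "x \<in> \<Omega>" and i: "i \<in> {1..CARD('n)}"
  shows "isCont (\<lambda>x. (v x i - f x i)\<^sup>2 / (v x i * (vmax - v x i))) x"
proof -
  have "L < s x i" "L < s x (i + 1)"
    using i by (auto intro!: Omega_spacing[OF x])
  moreover have "v x i * (vmax - v x i) \<noteq> 0"
    using Omega_speed[OF x i] by simp
  ultimately show ?thesis
    by (intro continuous_intros isCont_speed isCont_f)
qed

lemma isCont_H:
  assumes x: "x \<in> \<Omega>"
  shows "isCont H x"
proof -
  have "L < s x i" if "i \<in> {1..CARD('n)}" for i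
    using that by (auto intro!: Omega_spacing[OF x])
  then show ?thesis
    unfolding H_map_def by (intro continuous_intros isCont_kinetic x isCont_V_spacing)
qed

lemma isCont_dissipation:
  assumes x: "x \<in> \<Omega>"
  shows "isCont dissipation x"
proof -
  have "L < s x i" "L < s x (i + 1)" if "i \<in> {1..CARD('n)}" for i
    using that by (auto intro!: Omega_spacing[OF x])
  then show ?thesis
    unfolding dissipation_def
    by (intro continuous_intros isCont_kinetic x isCont_b_compose isCont_tension)
qed

lemma bounded_Omega: "bounded \<Omega>"
proof -
  have "\<Omega> \<subseteq> cbox 0 (\<chi> j. R) \<times> cbox 0 (\<chi> j. vmax)"
  proof
    fix x assume x: "x \<in> \<Omega>"
    have "0 \<le> fst x $ j \<and> fst x $ j \<le> R" for j
    proof -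
      obtain i where i: "i \<in> {2..CARD('n)}" "j = p i"
        using p_bij by (metis UNIV_I bij_betw_imp_surj_on imageE)
      then have j: "fst x $ j = s x i"
        by (simp add: spacing_def)
      have pos: "0 \<le> s x k" if "k \<in> {1..CARD('n)}" for k
        using Omega_spacing[OF x, of k] L_pos that by auto
      have "s x i \<le> (\<Sum>k=1..CARD('n). s x k)"
        using i by (intro member_le_sum) (auto intro: pos)
      then show ?thesis
        using pos[of i] i j sum_spacing[of x] by auto
    qed
    moreover have "0 \<le> snd x $ j \<and> snd x $ j \<le> vmax" for j
    proof -
      obtain i where "i \<in> {1..CARD('n)}" "j = q i"
        using q_bij by (metis UNIV_I bij_betw_imp_surj_on imageE)
      then show ?thesis
        using Omega_speed[OF x, of i] by (simp add: speed_def less_imp_le)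
    qed
    ultimately show "x \<in> cbox 0 (\<chi> j. R) \<times> cbox 0 (\<chi> j. vmax)"
      by (auto simp: mem_box_cart mem_Times_iff)
  qed
  then show ?thesis
    by (rule bounded_subset[rotated]) (intro bounded_Times bounded_cbox)
qed

lemma V_spacing_le_H:
  assumes x: "x \<in> \<Omega>" and i: "i \<in> {1..CARD('n)}"
  shows "V (s x i) \<le> H x"
proof -
  have "V (s x i) \<le> (\<Sum>i=1..CARD('n). V (s x i))"
    using i by (intro member_le_sum) (auto intro: V_spacing_nonneg[OF x])
  moreover have "0 \<le> vmax\<^sup>2 / 2 * (\<Sum>i=1..CARD('n). (v x i - f x i)\<^sup>2 / (v x i * (vmax - v x i)))"
    by (intro mult_nonneg_nonneg sum_nonneg kinetic_nonneg x) auto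
  ultimately show ?thesis
    by (simp add: H_map_def)
qed

text \<open>
  The bound on a kinetic term is kept in multiplied form, which passes to limits on the boundary of the state
  space.
\<close>

lemma kinetic_le_H:
  assumes x: "x \<in> \<Omega>" and i: "i \<in> {1..CARD('n)}"
  shows "vmax\<^sup>2 * (v x i - f x i)\<^sup>2 \<le> 2 * H x * (v x i * (vmax - v x i))"
proof -
  let ?k = "\<lambda>i. (v x i - f x i)\<^sup>2 / (v x i * (vmax - v x i))"
  have "vmax\<^sup>2 / 2 * ?k i \<le> vmax\<^sup>2 / 2 * (\<Sum>i=1..CARD('n). ?k i)"
    using i by (intro mult_left_mono member_le_sum) (auto intro: kinetic_nonneg[OF x])
  also have "\<dots> \<le> H x"
    unfolding H_map_def using V_spacing_nonneg[OF x] by (auto intro!: sum_nonneg)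
  finally show ?thesis
    using Omega_speed[OF x i] by (simp add: field_simps)
qed

text \<open>
  A spacing cannot tend to \<open>L\<close> because the potential would be unbounded. If a speed tended to \<open>0\<close> or to
  \<open>vmax\<close>, the limit of the inequality \<open>kinetic_le_H\<close> would force the speed to agree with the target speed, which
  lies strictly between these values.
\<close>

lemma limit_of_sublevel_in_Omega:
  assumes X: "\<And>k. X k \<in> \<Omega>" "\<And>k. H (X k) \<le> h" and lim: "X \<longlonglongrightarrow> x"
  shows "x \<in> \<Omega>"
proof -
  have lim_s: "(\<lambda>k. s (X k) i) \<longlonglongrightarrow> s x i" and lim_v: "(\<lambda>k. v (X k) i) \<longlonglongrightarrow> v x i" for i
    using isCont_tendsto_compose[OF isCont_spacing lim] isCont_tendsto_compose[OF isCont_speed lim]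
    by auto
  have s: "L < s x i" if i: "i \<in> {1..CARD('n)}" for i
  proof (rule ccontr)
    assume "\<not> L < s x i"
    moreover have gt: "L < s (X k) i" for k
      using i by (intro Omega_spacing[OF X(1)]) auto
    moreover have "L \<le> s x i"
      by (rule tendsto_lowerbound[OF lim_s]) (auto intro!: always_eventually less_imp_le[OF gt])
    moreover have "s (X k) i \<noteq> L" for k
      using gt[of k] by simp
    ultimately have "filterlim (\<lambda>k. s (X k) i) (at_right L) sequentially"
      using lim_s[of i] by (auto simp: filterlim_at intro!: always_eventually)
    then have "filterlim (\<lambda>k. V (s (X k) i)) at_top sequentially"
      by (rule filterlim_compose[OF V_barrier])
    then have "eventually (\<lambda>k. h < V (s (X k) i)) sequentially"
      by (simp add: filterlim_at_top_dense)
    then obtain k where "h < V (s (X k) i)"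
      by (auto simp: eventually_sequentially)
    then show False
      using V_spacing_le_H[OF X(1) i, of k] X(2)[of k] by simp
  qed
  have v: "0 < v x i \<and> v x i < vmax" if i: "i \<in> {1..CARD('n)}" for i
  proof -
    have ge: "0 \<le> v x i" and le: "v x i \<le> vmax"
      using Omega_speed[OF X(1) i]
      by (auto intro!: tendsto_lowerbound[OF lim_v] tendsto_upperbound[OF lim_v] always_eventually
          simp: less_imp_le)
    have lim_f: "(\<lambda>k. f (X k) i) \<longlonglongrightarrow> f x i"
      using isCont_tendsto_compose[OF isCont_f lim, of i] s spacing_gt[of L x "i + 1"] i by simp
    have "vmax\<^sup>2 * (v x i - f x i)\<^sup>2 \<le> 2 * h * (v x i * (vmax - v x i))"
    proof (rule tendsto_le)
      show "(\<lambda>k. 2 * h * (v (X k) i * (vmax - v (X k) i))) \<longlonglongrightarrow> 2 * h * (v x i * (vmax - v x i))"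
        "(\<lambda>k. vmax\<^sup>2 * (v (X k) i - f (X k) i)\<^sup>2) \<longlonglongrightarrow> vmax\<^sup>2 * (v x i - f x i)\<^sup>2"
        by (intro tendsto_intros lim_v lim_f)+
      have "vmax\<^sup>2 * (v (X k) i - f (X k) i)\<^sup>2 \<le> 2 * h * (v (X k) i * (vmax - v (X k) i))" for k
      proof -
        have "vmax\<^sup>2 * (v (X k) i - f (X k) i)\<^sup>2 \<le> 2 * H (X k) * (v (X k) i * (vmax - v (X k) i))"
          by (rule kinetic_le_H[OF X(1) i])
        also have "\<dots> \<le> 2 * h * (v (X k) i * (vmax - v (X k) i))"
          using X(2)[of k] Omega_speed[OF X(1) i, of k] by (intro mult_right_mono) auto
        finally show ?thesis .
      qed
      then show "eventually (\<lambda>k. vmax\<^sup>2 * (v (X k) i - f (X k) i)\<^sup>2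
          \<le> 2 * h * (v (X k) i * (vmax - v (X k) i))) sequentially"
        by simp
    qed simp
    then have "v x i = f x i" if "v x i = 0 \<or> v x i = vmax"
      using that vmax_pos by (auto simp: mult_le_0_iff)
    then show ?thesis
      using ge le f_bounds[of x i] by fastforce
  qed
  show ?thesis
    using s v by (simp add: Omega_iff)
qed

lemma compact_sublevel: "compact {x \<in> \<Omega>. H x \<le> h}"
proof -
  have "closed {x \<in> \<Omega>. H x \<le> h}"
    unfolding closed_sequential_limits
  proof (intro allI impI)
    fix X x assume X: "(\<forall>k. X k \<in> {x \<in> \<Omega>. H x \<le> h}) \<and> X \<longlonglongrightarrow> x"
    then have x: "x \<in> \<Omega>"
      using limit_of_sublevel_in_Omega[of X h x] by auto
    have "(\<lambda>k. H (X k)) \<longlonglongrightarrow> H x"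
      using isCont_tendsto_compose[OF isCont_H[OF x]] X by auto
    then have "H x \<le> h"
      by (rule tendsto_upperbound) (use X in auto)
    then show "x \<in> {x \<in> \<Omega>. H x \<le> h}"
      using x by simp
  qed
  moreover have "bounded {x \<in> \<Omega>. H x \<le> h}"
    using bounded_Omega by (rule bounded_subset) auto
  ultimately show ?thesis
    by (simp add: compact_eq_bounded_closed)
qed

section \<open>Dissipation along solutions\<close>

text \<open>
  The equation for \<open>s\<^sub>1\<close>, which is not a coordinate of the state, follows by telescoping from the other ones.
\<close>

lemma spacing_derivative:
  assumes d: "\<And>i. i \<in> {2..CARD('n)} \<Longrightarrow>
      ((\<lambda>\<tau>. s (x \<tau>) i) has_real_derivative v (x t) (i - 1) - v (x t) i) (at t within I)"
    and i: "i \<in> {1..CARD('n) + 1}"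
  shows "((\<lambda>\<tau>. s (x \<tau>) i) has_real_derivative v (x t) (i - 1) - v (x t) i) (at t within I)"
proof -
  have "((\<lambda>\<tau>. R - (\<Sum>i=2..CARD('n). s (x \<tau>) i)) has_real_derivative
      0 - (\<Sum>i=2..CARD('n). v (x t) (i - 1) - v (x t) i)) (at t within I)"
    by (intro DERIV_diff DERIV_const DERIV_sum d)
  also have "0 - (\<Sum>i=2..CARD('n). v (x t) (i - 1) - v (x t) i) = v (x t) 0 - v (x t) 1"
    using sum_differences[of "CARD('n)" "v (x t)"] n_ge_2 by (simp add: speed_0)
  finally have d1: "((\<lambda>\<tau>. s (x \<tau>) 1) has_real_derivative v (x t) 0 - v (x t) 1) (at t within I)"
    unfolding spacing_1 .
  consider "i = 1" | "i \<in> {2..CARD('n)}" | "i = CARD('n) + 1"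
    using i n_ge_2 by fastforce
  then show ?thesis
  proof cases
    case 1
    then show ?thesis
      using d1 by simp
  next
    case 2
    then show ?thesis
      by (rule d)
  next
    case 3
    have "v (x t) (i - 1) - v (x t) i = v (x t) 0 - v (x t) 1"
      by (simp only: 3 speed_Suc_n speed_0 add_diff_cancel_right')
    then show ?thesis
      using d1 by (simp only: 3 spacing_Suc_n)
  qed
qed

text \<open>
  Up to the factor \<open>vmax\<^sup>2\<close>, the feedback term \<open>Z\<close> is the time derivative of the target speed.
\<close>

lemma f_derivative:
  assumes d: "((\<lambda>\<tau>. s (x \<tau>) i) has_real_derivative v (x t) (i - 1) - v (x t) i) (at t within I)"
    "((\<lambda>\<tau>. s (x \<tau>) (i + 1)) has_real_derivative v (x t) i - v (x t) (i + 1)) (at t within I)"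
    and s: "L < s (x t) i" "L < s (x t) (i + 1)"
  shows "((\<lambda>\<tau>. f (x \<tau>) i) has_real_derivative Z (x t) i / vmax\<^sup>2) (at t within I)"
proof -
  have "((\<lambda>\<tau>. tension (x \<tau>) i) has_real_derivative
      deriv (deriv V) (s (x t) (i + 1)) * (v (x t) i - v (x t) (i + 1)) -
      deriv (deriv V) (s (x t) i) * (v (x t) (i - 1) - v (x t) i)) (at t within I)" (is "(_ has_real_derivative ?T') _")
    unfolding tension_def by (intro DERIV_diff DERIV_chain2[OF V_deriv(2)] d s)
  then have "((\<lambda>\<tau>. f (x \<tau>) i) has_real_derivative 0 - deriv b (tension (x t) i) * ?T') (at t within I)"
    unfolding f_eq by (intro DERIV_diff DERIV_const DERIV_chain2[OF b_deriv(1)])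
  also have "0 - deriv b (tension (x t) i) * ?T' = Z (x t) i / vmax\<^sup>2"
    using vmax_pos by (simp add: Z_map_def tension_def)
  finally show ?thesis .
qed

text \<open>
  The feedback turns each kinetic term into a damping term and the coupling
  \<open>- (v\<^sub>i - f\<^sub>i) T\<^sub>i\<close>. Together with the change of potential energy the part containing \<open>v\<^sub>i\<close> becomes a
  difference \<open>g i - g (i + 1)\<close>, and inserting \<open>f\<^sub>i = v\<^sup>* - b(T\<^sub>i)\<close> leaves \<open>- T\<^sub>i b(T\<^sub>i)\<close> and a multiple of
  \<open>T\<^sub>i\<close>; both differences cancel in the sum around the ring.
\<close>

lemma H_derivative:
  assumes x: "x t \<in> \<Omega>"
    and ds: "\<And>i. i \<in> {2..CARD('n)} \<Longrightarrow>
      ((\<lambda>\<tau>. s (x \<tau>) i) has_real_derivative v (x t) (i - 1) - v (x t) i) (at t within I)"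
    and dv: "\<And>i. i \<in> {1..CARD('n)} \<Longrightarrow>
      ((\<lambda>\<tau>. v (x \<tau>) i) has_real_derivative F (x t) i) (at t within I)"
  shows "((\<lambda>\<tau>. H (x \<tau>)) has_real_derivative - dissipation (x t)) (at t within I)"
proof -
  define y where "y = x t"
  define k where "k i = (v y i - f y i)\<^sup>2 / (v y i * (vmax - v y i))" for i
  define g where "g i = deriv V (s y i) * v y (i - 1)" for i
  have gt: "L < s y i" if "i \<in> {1..CARD('n) + 1}" for i
    using Omega_spacing[OF x, of i] that by (simp add: y_def)
  have ds': "((\<lambda>\<tau>. s (x \<tau>) i) has_real_derivative v y (i - 1) - v y i) (at t within I)"
    if "i \<in> {1..CARD('n) + 1}" for i
    using spacing_derivative[OF ds that] by (simp add: y_def)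
  have kin: "((\<lambda>\<tau>. vmax\<^sup>2 / 2 * ((v (x \<tau>) i - f (x \<tau>) i)\<^sup>2 / (v (x \<tau>) i * (vmax - v (x \<tau>) i))))
      has_real_derivative - (\<mu> * vmax\<^sup>2 * k i) - (v y i - f y i) * tension y i) (at t within I)"
    if i: "i \<in> {1..CARD('n)}" for i
  proof -
    have r: "0 < v y i" "v y i < vmax"
      using Omega_speed[OF x i] by (auto simp: y_def)
    have "((\<lambda>\<tau>. s (x \<tau>) (i + 1)) has_real_derivative v y i - v y (i + 1)) (at t within I)"
      using ds'[of "i + 1"] i by simp
    then have df: "((\<lambda>\<tau>. f (x \<tau>) i) has_real_derivative Z y i / vmax\<^sup>2) (at t within I)"
      using f_derivative[of x i t I] ds'[of i] gt[of i] gt[of "i + 1"] i by (simp add: y_def)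
    let ?\<beta> = "beta_map vmax (v y i) (f y i)"
    define X where "X = (Z y i - \<mu> * vmax\<^sup>2 * (v y i - f y i)) / (v y i * (vmax - v y i)) +
        deriv V (s y i) - deriv V (s y (i + 1))"
    have "F y i = 1 / ?\<beta> * X"
      by (simp only: F_map_def X_def)
    moreover have "?\<beta> \<noteq> 0"
      using beta_map_pos[OF r, of "f y i"] f_bounds[of y i] by simp
    ultimately have "?\<beta> * F y i = X"
      by simp
    then have "?\<beta> * F y i - vmax\<^sup>2 * (Z y i / vmax\<^sup>2) / (v y i * (vmax - v y i)) =
        - (\<mu> * vmax\<^sup>2 * (v y i - f y i) / (v y i * (vmax - v y i))) - tension y i"
      using vmax_pos by (simp add: X_def tension_def diff_divide_distrib)
    moreover have square: "u * (- (c * u / d) - w) = - (c * (u\<^sup>2 / d)) - u * w" for u c d w :: real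
      by (simp add: power2_eq_square algebra_simps)
    ultimately have "(v y i - f y i) * (?\<beta> * F y i - vmax\<^sup>2 * (Z y i / vmax\<^sup>2) / (v y i * (vmax - v y i))) =
        - (\<mu> * vmax\<^sup>2 * k i) - (v y i - f y i) * tension y i"
      by (simp only: square k_def)
    then show ?thesis
      using kinetic_term_derivative[OF dv[OF i] df, of vmax] r by (simp add: y_def)
  qed
  have pot: "((\<lambda>\<tau>. V (s (x \<tau>) i)) has_real_derivative deriv V (s y i) * (v y (i - 1) - v y i)) (at t within I)"
    if i: "i \<in> {1..CARD('n)}" for i
    using DERIV_chain2[OF V_deriv(1) ds'[of i]] gt[of i] i by (simp add: y_def)
  have "((\<lambda>\<tau>. H (x \<tau>)) has_real_derivative
      (\<Sum>i=1..CARD('n). - (\<mu> * vmax\<^sup>2 * k i) - (v y i - f y i) * tension y i) +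
      (\<Sum>i=1..CARD('n). deriv V (s y i) * (v y (i - 1) - v y i))) (at t within I)"
    unfolding H_map_def sum_distrib_left by (intro DERIV_add DERIV_sum kin pot)
  also have "(\<Sum>i=1..CARD('n). - (\<mu> * vmax\<^sup>2 * k i) - (v y i - f y i) * tension y i) +
      (\<Sum>i=1..CARD('n). deriv V (s y i) * (v y (i - 1) - v y i)) =
      (\<Sum>i=1..CARD('n). - (\<mu> * vmax\<^sup>2 * k i) - tension y i * b (tension y i) + (g i - g (i + 1)) +
        vstar * (deriv V (s y (i + 1)) - deriv V (s y i)))"
    unfolding sum.distrib[symmetric]
  proof (rule sum.cong[OF refl])
    fix i
    have V: "deriv V (s y (i + 1)) = tension y i + deriv V (s y i)"
      by (simp add: tension_def)
    show "- (\<mu> * vmax\<^sup>2 * k i) - (v y i - f y i) * tension y i + deriv V (s y i) * (v y (i - 1) - v y i) =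
        - (\<mu> * vmax\<^sup>2 * k i) - tension y i * b (tension y i) + (g i - g (i + 1)) +
        vstar * (deriv V (s y (i + 1)) - deriv V (s y i))"
      by (simp only: g_def f_eq V add_diff_cancel_right') (simp add: algebra_simps)
  qed
  also have "\<dots> = - dissipation y + ((\<Sum>i=1..CARD('n). g i) - (\<Sum>i=1..CARD('n). g (i + 1))) +
      vstar * ((\<Sum>i=1..CARD('n). deriv V (s y (i + 1))) - (\<Sum>i=1..CARD('n). deriv V (s y i)))"
    by (simp add: dissipation_def k_def sum.distrib sum_subtractf sum_negf sum_distrib_left
        right_diff_distrib)
  also have "(\<Sum>i=1..CARD('n). g (i + 1)) = (\<Sum>i=1..CARD('n). g i)"
    by (rule sum_cyclic_shift) (simp only: g_def spacing_Suc_n add_diff_cancel_right' speed_0 diff_self_eq_0)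
  also have "(\<Sum>i=1..CARD('n). deriv V (s y (i + 1))) = (\<Sum>i=1..CARD('n). deriv V (s y i))"
    by (rule sum_cyclic_shift) (simp only: spacing_Suc_n)
  finally show ?thesis
    by (simp add: y_def)
qed

section \<open>The closed-loop vector field\<close>

text \<open>
  The right-hand side in the coordinates of the state vector, to which the general theory of differential
  equations applies.
\<close>

definition field :: "('m, 'n) state \<Rightarrow> ('m, 'n) state" where
  "field x =
     (\<chi> j. let i = inv_into {2..CARD('n)} p j in v x (i - 1) - v x i,
      \<chi> j. F x (inv_into {1..CARD('n)} q j))"

lemma field_components:
  "i \<in> {2..CARD('n)} \<Longrightarrow> fst (field x) $ p i = v x (i - 1) - v x i"
  "i \<in> {1..CARD('n)} \<Longrightarrow> snd (field x) $ q i = F x i"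
  using bij_betw_inv_into_left[OF p_bij, of i] bij_betw_inv_into_left[OF q_bij, of i]
  by (simp_all add: field_def)

lemma coordinates:
  "i \<in> {2..CARD('n)} \<Longrightarrow> s x i = fst x $ p i"
  "i \<in> {1..CARD('n)} \<Longrightarrow> v x i = snd x $ q i"
  by (auto simp: spacing_def speed_def)

lemma solution_iff_field:
  "(\<forall>i\<in>{2..CARD('n)}. ((\<lambda>\<tau>. s (x \<tau>) i) has_real_derivative v (x t) (i - 1) - v (x t) i) (at t within I)) \<and>
   (\<forall>i\<in>{1..CARD('n)}. ((\<lambda>\<tau>. v (x \<tau>) i) has_real_derivative F (x t) i) (at t within I)) \<longleftrightarrow>
   (x has_vector_derivative field (x t)) (at t within I)" (is "?coord \<longleftrightarrow> ?field")
proof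
  assume c: ?coord
  have "((\<lambda>\<tau>. fst (x \<tau>)) has_vector_derivative fst (field (x t))) (at t within I)"
  proof (rule has_vector_derivative_vec)
    fix j
    obtain i where i: "i \<in> {2..CARD('n)}" "j = p i"
      using p_bij by (metis UNIV_I bij_betw_imp_surj_on imageE)
    then have "((\<lambda>\<tau>. s (x \<tau>) i) has_vector_derivative v (x t) (i - 1) - v (x t) i) (at t within I)"
      using c by (simp add: has_real_derivative_iff_has_vector_derivative)
    then show "((\<lambda>\<tau>. fst (x \<tau>) $ j) has_vector_derivative fst (field (x t)) $ j) (at t within I)"
      by (simp only: i(2) field_components(1)[OF i(1)] coordinates(1)[OF i(1)])
  qed
  moreover have "((\<lambda>\<tau>. snd (x \<tau>)) has_vector_derivative snd (field (x t))) (at t within I)"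
  proof (rule has_vector_derivative_vec)
    fix j
    obtain i where i: "i \<in> {1..CARD('n)}" "j = q i"
      using q_bij by (metis UNIV_I bij_betw_imp_surj_on imageE)
    then have "((\<lambda>\<tau>. v (x \<tau>) i) has_vector_derivative F (x t) i) (at t within I)"
      using c by (simp add: has_real_derivative_iff_has_vector_derivative)
    then show "((\<lambda>\<tau>. snd (x \<tau>) $ j) has_vector_derivative snd (field (x t)) $ j) (at t within I)"
      by (simp only: i(2) field_components(2)[OF i(1)] coordinates(2)[OF i(1)])
  qed
  ultimately show ?field
    using has_vector_derivative_Pair by fastforce
next
  assume d: ?field
  show ?coord
  proof (intro conjI ballI)
    fix i assume i: "i \<in> {2..CARD('n)}"
    have "((\<lambda>\<tau>. fst (x \<tau>) $ p i) has_vector_derivative fst (field (x t)) $ p i) (at t within I)"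
      by (rule bounded_linear.has_vector_derivative[OF
            bounded_linear_compose[OF bounded_linear_vec_nth bounded_linear_fst] d])
    then show "((\<lambda>\<tau>. s (x \<tau>) i) has_real_derivative v (x t) (i - 1) - v (x t) i) (at t within I)"
      by (simp only: has_real_derivative_iff_has_vector_derivative field_components(1)[OF i]
          coordinates(1)[OF i])
  next
    fix i assume i: "i \<in> {1..CARD('n)}"
    have "((\<lambda>\<tau>. snd (x \<tau>) $ q i) has_vector_derivative snd (field (x t)) $ q i) (at t within I)"
      by (rule bounded_linear.has_vector_derivative[OF
            bounded_linear_compose[OF bounded_linear_vec_nth bounded_linear_snd] d])
    then show "((\<lambda>\<tau>. v (x \<tau>) i) has_real_derivative F (x t) i) (at t within I)"
      by (simp only: has_real_derivative_iff_has_vector_derivative field_components(2)[OF i]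
          coordinates(2)[OF i])
  qed
qed

lemma lipschitz_near_deriv_V_spacing:
  assumes "L < s x i"
  shows "lipschitz_near (\<lambda>x. deriv V (s x i)) x"
  by (rule lipschitz_near_compose[OF lipschitz_near_spacing])
    (rule lipschitz_near_C1[OF open_greaterThan _ V_deriv(2) V_deriv_cont(2)]; use assms in simp)

lemma lipschitz_near_deriv2_V_spacing:
  assumes "L < s x i"
  shows "lipschitz_near (\<lambda>x. deriv (deriv V) (s x i)) x"
  by (rule lipschitz_near_compose[OF lipschitz_near_spacing])
    (rule lipschitz_near_C1[OF open_greaterThan _ V_deriv(3) V_deriv_cont(3)]; use assms in simp)

lemma lipschitz_near_tension:
  assumes "L < s x i" "L < s x (i + 1)"
  shows "lipschitz_near (\<lambda>x. tension x i) x"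
  unfolding tension_def by (intro lipschitz_near_diff lipschitz_near_deriv_V_spacing assms)

lemma lipschitz_near_f:
  assumes "L < s x i" "L < s x (i + 1)"
  shows "lipschitz_near (\<lambda>x. f x i) x"
  unfolding f_eq
  by (rule lipschitz_near_diff[OF lipschitz_near_const
        lipschitz_near_compose[OF lipschitz_near_tension[OF assms]
          lipschitz_near_C1[OF open_UNIV UNIV_I b_deriv(1) b_deriv_cont(1)]]])

lemma lipschitz_near_deriv_b_tension:
  assumes "L < s x i" "L < s x (i + 1)"
  shows "lipschitz_near (\<lambda>x. deriv b (tension x i)) x"
  by (rule lipschitz_near_compose[OF lipschitz_near_tension[OF assms]
        lipschitz_near_C1[OF open_UNIV UNIV_I b_deriv(2) b_deriv_cont(2)]])

text \<open>
  The accelerations contain \<open>V''\<close> and \<open>b'\<close>; this is where three derivatives of \<open>V\<close> and two derivatives of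
  \<open>b\<close> are needed.
\<close>

lemma lipschitz_near_F:
  assumes x: "x \<in> \<Omega>" and i: "i \<in> {1..CARD('n)}"
  shows "lipschitz_near (\<lambda>x. F x i) x"
proof -
  have s: "L < s x i" "L < s x (i + 1)"
    using i by (auto intro!: Omega_spacing[OF x])
  have v: "v x i * (vmax - v x i) \<noteq> 0" "2 * (vmax - v x i)\<^sup>2 * (v x i)\<^sup>2 \<noteq> 0"
    using Omega_speed[OF x i] by auto
  have \<beta>: "beta_map vmax (v x i) (f x i) \<noteq> 0"
    using beta_map_pos[of "v x i" vmax "f x i"] Omega_speed[OF x i] f_bounds[of x i] by simp
  have "lipschitz_near (\<lambda>x. beta_map vmax (v x i) (f x i)) x"
    unfolding beta_map_def
    by (intro lipschitz_near_divide lipschitz_near_diff lipschitz_near_mult lipschitz_near_add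
        lipschitz_near_power lipschitz_near_const lipschitz_near_speed lipschitz_near_f s v)
  moreover have "lipschitz_near (\<lambda>x. Z x i) x"
    unfolding Z_map_def tension_def[symmetric]
    by (intro lipschitz_near_diff lipschitz_near_mult lipschitz_near_const lipschitz_near_speed
        lipschitz_near_deriv_b_tension lipschitz_near_deriv2_V_spacing s)
  ultimately show ?thesis
    unfolding F_map_def
    by (intro lipschitz_near_divide lipschitz_near_diff lipschitz_near_mult lipschitz_near_add
        lipschitz_near_const lipschitz_near_speed lipschitz_near_f lipschitz_near_deriv_V_spacing s v \<beta>)
qed

lemma lipschitz_near_field:
  assumes x: "x \<in> \<Omega>"
  shows "lipschitz_near field x"
proof (rule lipschitz_near_euclidean)
  have fst: "lipschitz_near (\<lambda>x. fst (field x) $ j) x" for j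
  proof -
    obtain i where i: "i \<in> {2..CARD('n)}" "j = p i"
      using p_bij by (metis UNIV_I bij_betw_imp_surj_on imageE)
    show ?thesis
      unfolding i(2) field_components(1)[OF i(1)]
      by (intro lipschitz_near_diff lipschitz_near_speed)
  qed
  have snd: "lipschitz_near (\<lambda>x. snd (field x) $ j) x" for j
  proof -
    obtain i where i: "i \<in> {1..CARD('n)}" "j = q i"
      using q_bij by (metis UNIV_I bij_betw_imp_surj_on imageE)
    show ?thesis
      unfolding i(2) field_components(2)[OF i(1)] by (rule lipschitz_near_F[OF x i(1)])
  qed
  fix e :: "('m, 'n) state" assume "e \<in> Basis"
  then consider j where "e = (axis j 1, 0)" | j where "e = (0, axis j 1)"
    by (auto simp: Basis_prod_def Basis_vec_def)
  then show "lipschitz_near (\<lambda>x. field x \<bullet> e) x"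
    by cases (simp_all add: inner_prod_def inner_axis fst snd)
qed

lemma open_Omega: "open \<Omega>"
proof -
  have cont: "continuous_on UNIV (\<lambda>x. s x i)" "continuous_on UNIV (\<lambda>x. v x i)" for i
    by (simp_all add: continuous_at_imp_continuous_on isCont_spacing isCont_speed)
  have "\<Omega> = (\<Inter>i\<in>{1..CARD('n)}. {x. L < s x i} \<inter> {x. 0 < v x i} \<inter> {x. v x i < vmax})"
    by (auto simp: Omega_iff)
  also have "open \<dots>"
    by (intro open_INT finite_atLeastAtMost ballI open_Int open_Collect_less cont continuous_on_const)
  finally show ?thesis .
qed

section \<open>Solutions\<close>

abbreviation solution :: "ereal \<Rightarrow> (real \<Rightarrow> ('m, 'n) state) \<Rightarrow> bool" where
  "solution \<equiv> is_solution p q R L vmax vstar \<mu> V b"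

lemma solution_iff:
  "solution T x \<longleftrightarrow> 0 < T \<and> (\<forall>t. 0 \<le> t \<and> ereal t < T \<longrightarrow>
     x t \<in> \<Omega> \<and> (x has_vector_derivative field (x t)) (at t within {\<tau>. 0 \<le> \<tau> \<and> ereal \<tau> < T}))"
  unfolding is_solution_def solution_iff_field ..

lemma H_derivative_solution:
  assumes "solution T x" "0 \<le> t" "ereal t < T"
  shows "((\<lambda>\<tau>. H (x \<tau>)) has_real_derivative - dissipation (x t))
    (at t within {\<tau>. 0 \<le> \<tau> \<and> ereal \<tau> < T})"
  using assms unfolding is_solution_def by (intro H_derivative) auto

lemma H_nonincreasing:
  assumes sol: "solution T x" and t: "0 \<le> t" "ereal t < T"
  shows "H (x t) \<le> H (x 0)"
proof (rule nonincreasing_if_derivative_nonpos_within[where f = "\<lambda>\<tau>. H (x \<tau>)"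
      and f' = "\<lambda>\<tau>. - dissipation (x \<tau>)" and I = "{\<tau>. 0 \<le> \<tau> \<and> ereal \<tau> < T}"])
  have lt: "ereal u < T" if "u \<in> {0..t}" for u
    using that t(2) by (auto intro: le_less_trans[of "ereal u" "ereal t"])
  show "((\<lambda>\<tau>. H (x \<tau>)) has_real_derivative - dissipation (x u))
    (at u within {\<tau>. 0 \<le> \<tau> \<and> ereal \<tau> < T})" "- dissipation (x u) \<le> 0" if "u \<in> {0..t}" for u
    using H_derivative_solution[OF sol, of u] dissipation_nonneg[of "x u"] sol lt[OF that] that
    by (auto simp: is_solution_def)
  show "{0..t} \<subseteq> {\<tau>. 0 \<le> \<tau> \<and> ereal \<tau> < T}"
    using lt by auto
qed (rule t(1))

text \<open>
  At a finite end time the solution would lie in the compact sublevel set of its initial value and could be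
  extended.
\<close>

lemma maximal_solution_global:
  assumes max: "is_maximal_solution p q R L vmax vstar \<mu> V b T x"
  shows "T = \<infinity>"
proof (rule ccontr)
  have sol: "solution T x"
    using max by (simp add: is_maximal_solution_def)
  assume "T \<noteq> \<infinity>"
  then obtain r where r: "T = ereal r" "0 < r"
    using sol by (cases T) (auto simp: is_solution_def)
  have I: "{\<tau>. 0 \<le> \<tau> \<and> \<tau> < c} = {0..<c}" for c :: real
    by auto
  let ?K = "{y \<in> \<Omega>. H y \<le> H (x 0)}"
  have "x t \<in> ?K" "(x has_vector_derivative field (x t)) (at t within {0..<r})" if "t \<in> {0..<r}" for t
    using sol H_nonincreasing[OF sol, of t] that by (auto simp: solution_iff r I)
  then obtain r' y where y: "r < r'" "\<And>t. t \<in> {0..<r} \<Longrightarrow> y t = x t"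
    "\<And>t. t \<in> {0..<r'} \<Longrightarrow> y t \<in> \<Omega>"
    "\<And>t. t \<in> {0..<r'} \<Longrightarrow> (y has_vector_derivative field (y t)) (at t within {0..<r'})"
    using solution_extends_beyond_compact[OF open_Omega lipschitz_near_field compact_sublevel _ r(2), of _ x]
    by (metis (no_types, lifting) mem_Collect_eq subsetI)
  then have "solution (ereal r') y"
    using r(2) by (auto simp: solution_iff I)
  then have "\<exists>T' y. T < T' \<and> solution T' y \<and> (\<forall>t. 0 \<le> t \<and> ereal t < T \<longrightarrow> y t = x t)"
    using y(1,2) by (intro exI[of _ "ereal r'"] exI[of _ y]) (auto simp: r)
  then show False
    using max by (simp add: is_maximal_solution_def)
qed

lemma decay_estimate:
  obtains \<sigma> where "class_KL \<sigma>"
    "\<And>x t. solution \<infinity> x \<Longrightarrow> 0 \<le> t \<Longrightarrow> H (x t) \<le> \<sigma> (H (x 0)) t"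
proof -
  obtain e where e: "e \<in> E"
    using E_nonempty by blast
  have e\<Omega>: "e \<in> \<Omega>"
    using e E_subset_Omega by blast
  have W0: "H x = 0" if "x \<in> \<Omega>" "dissipation x = 0" for x
    by (rule on_E(1)[OF dissipation_eq_0_imp_E[OF that]])
  show thesis
  proof (rule class_KL_of_dissipation[where X = \<Omega> and W = dissipation and H = H and e = e])
    show "continuous_on \<Omega> dissipation" "continuous_on \<Omega> H"
      by (auto intro: continuous_at_imp_continuous_on isCont_dissipation isCont_H)
    fix \<sigma>
    assume KL: "class_KL \<sigma>"
      and \<sigma>: "\<And>x t. \<lbrakk>\<And>t. 0 \<le> t \<Longrightarrow> x t \<in> \<Omega>;
       \<And>t. 0 \<le> t \<Longrightarrow> ((\<lambda>t. H (x t)) has_real_derivative - dissipation (x t)) (at t within {0..}); 0 \<le> t\<rbrakk>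
     \<Longrightarrow> H (x t) \<le> \<sigma> (H (x 0)) t"
    show thesis
    proof (rule that[OF KL])
      fix x and t :: real assume sol: "solution \<infinity> x" and t: "0 \<le> t"
      have I: "{\<tau>. 0 \<le> \<tau> \<and> ereal \<tau> < \<infinity>} = {0..}"
        by auto
      show "H (x t) \<le> \<sigma> (H (x 0)) t"
      proof (rule \<sigma>[OF _ _ t])
        fix u :: real assume "0 \<le> u"
        then show "x u \<in> \<Omega>"
          "((\<lambda>t. H (x t)) has_real_derivative - dissipation (x u)) (at u within {0..})"
          using sol H_derivative_solution[OF sol, of u] unfolding I by (auto simp: is_solution_def)
      qed
    qed
  qed (use compact_sublevel dissipation_nonneg H_nonneg W0 e\<Omega> on_E(2)[OF e] in auto)
qed

text \<open>
  At distance at least \<open>d\<close> from \<open>E\<close> and below the level \<open>1\<close>, the continuous function \<open>H\<close> attains a positive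
  minimum on a compact set.
\<close>

lemma distance_estimate:
  obtains a where "class_K_inf a" "\<And>x. x \<in> \<Omega> \<Longrightarrow> a (infdist x E) \<le> H x"
proof -
  obtain e where e: "e \<in> E" "e \<in> \<Omega>"
    using E_nonempty E_subset_Omega by blast
  obtain M where M: "\<And>x. x \<in> \<Omega> \<Longrightarrow> dist e x \<le> M"
    using bounded_Omega bounded_any_center[of \<Omega> e] by auto
  have away: "\<exists>m>0. \<forall>x\<in>\<Omega>. d \<le> infdist x E \<longrightarrow> m \<le> H x" if d: "0 < d" for d
  proof -
    define A where "A = {x \<in> \<Omega>. H x \<le> 1} \<inter> {x. d \<le> infdist x E}"
    have "closed {x. d \<le> infdist x E}"
      by (intro closed_Collect_le continuous_intros)
    then have A: "compact A"
      unfolding A_def using compact_sublevel by (rule compact_Int_closed[rotated])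
    have pos: "0 < H x" if "x \<in> A" for x
    proof -
      have x: "x \<in> \<Omega>" "x \<notin> E"
        using that d by (auto simp: A_def)
      then show ?thesis
        using H_nonneg[OF x(1)] H_eq_0_imp_E[OF x(1)] by fastforce
    qed
    obtain m where m: "0 < m" "\<And>x. x \<in> A \<Longrightarrow> m \<le> H x"
    proof (cases "A = {}")
      case True
      then show ?thesis
        using that[of 1] by simp
    next
      case False
      have "continuous_on A H"
        by (auto intro!: continuous_at_imp_continuous_on isCont_H simp: A_def)
      then obtain z where "z \<in> A" "\<And>x. x \<in> A \<Longrightarrow> H z \<le> H x"
        using continuous_attains_inf[OF A False] by blast
      then show ?thesis
        using that[of "H z"] pos by blast
    qed
    have "min m 1 \<le> H x" if "x \<in> \<Omega>" "d \<le> infdist x E" for x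
      using m(2)[of x] that by (cases "H x \<le> 1") (auto simp: A_def)
    then show ?thesis
      using m(1) by (intro exI[of _ "min m 1"]) auto
  qed
  show thesis
  proof (rule class_K_inf_lower_bound[where X = \<Omega> and D = "\<lambda>x. infdist x E" and M = M, OF _ _ H_nonneg e(2) on_E(1)[OF e(1)] away])
    show "infdist x E \<le> M" if "x \<in> \<Omega>" for x
      using infdist_le[OF e(1), of x] M[OF that] by (simp add: dist_commute)
  qed (use that in \<open>auto simp: infdist_nonneg\<close>)
qed

end

theorem theorem2:
  fixes p :: "nat \<Rightarrow> 'm::finite" and q :: "nat \<Rightarrow> 'n::finite"
    and R L lam vmax vstar \<mu> :: real
    and V b :: "real \<Rightarrow> real"
  assumes "2 \<le> CARD('n)"
    and "bij_betw p {2..CARD('n)} UNIV"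
    and "bij_betw q {1..CARD('n)} UNIV"
    and "0 < R"
    and "0 < L" and "L < R / real CARD('n)"
    and "L < lam"
    and "0 < vmax"
    and "0 < vstar" and "vstar < vmax"
    and "0 < \<mu>"
    and "Ck_on 3 V {L<..}"
    and "\<forall>x>L. 0 \<le> V x"
    and "filterlim V at_top (at_right L)"
    and "\<forall>x\<ge>lam. V x = 0"
    and "\<forall>x. L < x \<and> x < lam \<longrightarrow> deriv V x < 0 \<and> deriv (deriv V) x > 0"
    and "range b \<subseteq> {vstar - vmax<..<vstar}"
    and "Ck_on 2 b UNIV"
    and "strict_mono b"
    and "b 0 = 0"
    and "\<forall>x. x \<noteq> 0 \<longrightarrow> x * b x > 0"
    and "deriv b 0 > 0"
    and "R \<ge> real CARD('n) * lam"
  shows "\<exists>\<sigma> a. class_KL \<sigma> \<and> class_K_inf a \<and>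
    (\<forall>T (x :: real \<Rightarrow> ('m, 'n) state).
       is_maximal_solution p q R L vmax vstar \<mu> V b T x \<longrightarrow>
       T = \<infinity> \<and>
       (\<forall>t\<ge>0.
          a (infdist (x t) (E_set p q R lam vstar)) \<le> H_map p q R vmax vstar V b (x t) \<and>
          H_map p q R vmax vstar V b (x t) \<le> \<sigma> (H_map p q R vmax vstar V b (x 0)) t))"
proof -
  interpret ring_road p q R L lam vmax vstar \<mu> V b
    by unfold_locales (use assms in auto)
  obtain \<sigma> where \<sigma>: "class_KL \<sigma>" "\<And>x t. solution \<infinity> x \<Longrightarrow> 0 \<le> t \<Longrightarrow> H (x t) \<le> \<sigma> (H (x 0)) t"
    using decay_estimate by blast
  obtain a where a: "class_K_inf a" "\<And>x. x \<in> \<Omega> \<Longrightarrow> a (infdist x E) \<le> H x"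
    using distance_estimate by blast
  show ?thesis
  proof (intro exI[of _ \<sigma>] exI[of _ a] conjI allI impI)
    fix T and x :: "real \<Rightarrow> ('m, 'n) state"
    assume max: "is_maximal_solution p q R L vmax vstar \<mu> V b T x"
    show T: "T = \<infinity>"
      by (rule maximal_solution_global[OF max])
    then have sol: "solution \<infinity> x"
      using max by (simp add: is_maximal_solution_def)
    fix t :: real assume t: "0 \<le> t"
    show "a (infdist (x t) E) \<le> H (x t)"
      using sol t by (intro a(2)) (simp add: is_solution_def)
    show "H (x t) \<le> \<sigma> (H (x 0)) t"
      by (rule \<sigma>(2)[OF sol t])
  qed (fact \<sigma>(1) a(1))+
qed

end
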